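(* Let $\rho$ be a random time on $(\Omega,\mathcal{F},(\mathcal{F}_t)_{t\ge 0},\mathbb{P})$ with $\mathbb{P}[\rho=\infty]=0$. The following properties are equivalent: (1) $\rho$ is an $(\mathcal{F}_t)$ pseudo-stopping time; (2) for every uniformly integrable $(\mathcal{F}_t)$-martingale $(M_t)$ one has $\mathbb{E}[|M_\rho|]\le\mathbb{E}[|M_\infty|]$.
   Context: $(\Omega,\mathcal{F},(\mathcal{F}_t)_{t\ge0},\mathbb{P})$ is a filtered probability space satisfying the usual conditions; martingales are taken càdlàg, and $M_\infty=\lim_{t\to\infty}M_t$ for a uniformly integrable martingale. A random time is an $\mathcal{F}$-measurable nonnegative random variable (not necessarily a stopping time). $\mathcal{H}^1$ is the space of càdlàg $(\mathcal{F}_t)$-martingales $M$ with $\mathbb{E}[\sup_{t\ge 0}|M_t|]<\infty$. A random time $\rho$ is an $(\mathcal{F}_t)$ pseudo-stopping time if $\mathbb{E}[M_\rho]=\mathbb{E}[M_0]$ for every $(\mathcal{F}_t)$-martingale $M$ in $\mathcal{H}^1$ (equivalently, for every bounded $(\mathcal{F}_t)$-martingale). *)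

theory Defs
  imports "HOL-Probability.Probability"
begin

text \<open>
  Time is the half-line \<open>{0..}\<close> of the reals: filtrations and processes are functions on \<open>real\<close>,
  and nothing is assumed about their values at negative times. Of each measure \<open>F t\<close> only the
  sigma-algebra matters; all probabilities are taken with respect to \<open>P\<close>.
\<close>

locale usual_filtered_prob_space = prob_space P
  for P :: "'a measure" +
  fixes F :: "real \<Rightarrow> 'a measure"
  assumes subalgebra_F: "0 \<le> t \<Longrightarrow> subalgebra P (F t)"
    and F_mono: "0 \<le> s \<Longrightarrow> s \<le> t \<Longrightarrow> sets (F s) \<subseteq> sets (F t)"
    and F_complete: "N \<in> null_sets P \<Longrightarrow> A \<subseteq> N \<Longrightarrow> A \<in> sets (F 0)"
    and F_right_continuous: "0 \<le> t \<Longrightarrow> (\<Inter>s\<in>{t<..}. sets (F s)) = sets (F t)"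

definition cadlag :: "(real \<Rightarrow> real) \<Rightarrow> bool" where
  "cadlag f \<longleftrightarrow>
     (\<forall>t\<ge>0. continuous (at_right t) f) \<and> (\<forall>t>0. \<exists>l. (f \<longlongrightarrow> l) (at_left t))"

definition cadlag_martingale ::
    "'a measure \<Rightarrow> (real \<Rightarrow> 'a measure) \<Rightarrow> (real \<Rightarrow> 'a \<Rightarrow> real) \<Rightarrow> bool" where
  "cadlag_martingale P F M \<longleftrightarrow>
     (\<forall>t\<ge>0. M t \<in> borel_measurable (F t)) \<and>
     (\<forall>t\<ge>0. integrable P (M t)) \<and>
     (\<forall>s\<ge>0. \<forall>t\<ge>s. AE \<omega> in P. real_cond_exp P (F s) (M t) \<omega> = M s \<omega>) \<and>
     (\<forall>\<omega>\<in>space P. cadlag (\<lambda>t. M t \<omega>))"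

definition uniformly_integrable ::
    "'a measure \<Rightarrow> 'i set \<Rightarrow> ('i \<Rightarrow> 'a \<Rightarrow> real) \<Rightarrow> bool" where
  "uniformly_integrable P I X \<longleftrightarrow>
     (\<forall>i\<in>I. X i \<in> borel_measurable P) \<and>
     ((\<lambda>K::real. SUP i\<in>I. \<integral>\<^sup>+\<omega>\<in>{\<omega>. K \<le> \<bar>X i \<omega>\<bar>}. ennreal \<bar>X i \<omega>\<bar> \<partial>P) \<longlongrightarrow> 0) at_top"

definition ui_martingale ::
    "'a measure \<Rightarrow> (real \<Rightarrow> 'a measure) \<Rightarrow> (real \<Rightarrow> 'a \<Rightarrow> real) \<Rightarrow> bool" where
  "ui_martingale P F M \<longleftrightarrow> cadlag_martingale P F M \<and> uniformly_integrable P {0..} M"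

definition H1_martingale ::
    "'a measure \<Rightarrow> (real \<Rightarrow> 'a measure) \<Rightarrow> (real \<Rightarrow> 'a \<Rightarrow> real) \<Rightarrow> bool" where
  "H1_martingale P F M \<longleftrightarrow>
     cadlag_martingale P F M \<and> (\<integral>\<^sup>+\<omega>. (SUP t\<in>{0..}. ennreal \<bar>M t \<omega>\<bar>) \<partial>P) < \<infinity>"

text \<open>
  For a uniformly integrable martingale the limit exists outside a null set, and on that null set
  \<open>Lim\<close> is a fixed arbitrary value.
\<close>

definition terminal_value :: "(real \<Rightarrow> 'a \<Rightarrow> real) \<Rightarrow> 'a \<Rightarrow> real" where
  "terminal_value M \<omega> = Lim at_top (\<lambda>t. M t \<omega>)"

definition random_time :: "'a measure \<Rightarrow> ('a \<Rightarrow> ennreal) \<Rightarrow> bool" where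
  "random_time P \<rho> \<longleftrightarrow> \<rho> \<in> borel_measurable P"

definition value_at :: "(real \<Rightarrow> 'a \<Rightarrow> real) \<Rightarrow> ('a \<Rightarrow> ennreal) \<Rightarrow> 'a \<Rightarrow> real" where
  "value_at M \<rho> \<omega> =
     (if \<rho> \<omega> = \<infinity> then terminal_value M \<omega> else M (enn2real (\<rho> \<omega>)) \<omega>)"

definition pseudo_stopping_time ::
    "'a measure \<Rightarrow> (real \<Rightarrow> 'a measure) \<Rightarrow> ('a \<Rightarrow> ennreal) \<Rightarrow> bool" where
  "pseudo_stopping_time P F \<rho> \<longleftrightarrow>
     random_time P \<rho> \<and>
     (\<forall>M. H1_martingale P F M \<longrightarrow> (\<integral>\<omega>. value_at M \<rho> \<omega> \<partial>P) = (\<integral>\<omega>. M 0 \<omega> \<partial>P))"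

end

theory Submission
  imports Defs
begin

text \<open>
  Write \<open>T\<close> for the terminal value of a uniformly integrable martingale \<open>M\<close>.

  From the contraction property to the pseudo-stopping property, shift by a large constant. If \<open>M\<close> is
  in \<open>H\<^sup>1\<close>, so is \<open>c + a M\<close>, hence \<open>E\<bar>c + a M\<^sub>\<rho>\<bar> - c \<le> E\<bar>c + a T\<bar> - c\<close> for all \<open>c\<close>. For \<open>c\<close> tending to infinity
  the absolute values disappear, leaving \<open>a E M\<^sub>\<rho> \<le> a E T\<close>. The choices \<open>a = 1\<close> and \<open>a = -1\<close> give
  \<open>E M\<^sub>\<rho> = E T = E M\<^sub>0\<close>.

  Conversely, suppose that \<open>\<rho>\<close> is a pseudo-stopping time. The idea is to split
  \<open>M = E[T\<^sup>+ | F] - E[T\<^sup>- | F]\<close>: if evaluation at \<open>\<rho>\<close> preserved the expectation of both terms, then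
  \<open>E\<bar>M\<^sub>\<rho>\<bar> \<le> E T\<^sup>+ + E T\<^sup>- = E\<bar>T\<bar>\<close>. The hypothesis only speaks of \<open>H\<^sup>1\<close>, so both parts of \<open>T\<close> are cut off at
  a level \<open>k\<close>. They then close bounded cadlag martingales \<open>A\<close> and \<open>D\<close>, to which the hypothesis applies.
  The difference \<open>Z = M - (A - D)\<close> is closed by a variable of \<open>L\<^sup>1\<close> norm \<open>E(\<bar>T\<bar> - k)\<^sup>+\<close>, which tends to \<open>0\<close>,
  and Doob's maximal inequality bounds \<open>Z\<close> uniformly in time, hence also at \<open>\<rho>\<close>, however \<open>\<rho>\<close> is chosen
  (\<open>pseudo_stopping_time_truncated_estimate\<close>).

  Two parts of classical martingale theory carry this argument.

  \<^item> The terminal value exists and closes \<open>M\<close>. Jensen's inequality for the strictly convex function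
    \<open>sqrt (1 + x\<^sup>2)\<close>, with its Bregman divergence as the remainder, shows that \<open>M\<close> is Cauchy in \<open>L\<^sup>1\<close>
    (\<open>ui_martingale_L1_Cauchy\<close>). The maximal inequality, applied to the increments after a late time,
    turns this into pathwise convergence (\<open>cadlag_ui_martingale_converges\<close>).

  \<^item> A bounded variable closes a cadlag martingale (\<open>bounded_cadlag_version\<close>). Choose any versions
    of the conditional expectations and look at them at dyadic times. If, for every
    \<open>e > 0\<close>, the number of \<open>e\<close>-jumps of a path along finer and finer dyadic grids does not tend to
    infinity, then the path has one-sided limits.
    Orthogonality of martingale increments bounds the expected number of \<open>e\<close>-jumps by
    \<open>B\<^sup>2 / e\<^sup>2\<close>, whatever the grid (\<open>expected_jumps_le\<close>), so almost every path is of this kind; the limits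
    from the right are the version, adapted because the filtration is complete and right-continuous.
\<close>

section \<open>Martingales tested against bounded adapted factors\<close>

locale filtered_prob_space = prob_space P
  for P :: "'a measure" +
  fixes F :: "real \<Rightarrow> 'a measure"
  assumes subalg_F: "0 \<le> t \<Longrightarrow> subalgebra P (F t)"
    and mono_F: "0 \<le> s \<Longrightarrow> s \<le> t \<Longrightarrow> sets (F s) \<subseteq> sets (F t)"

text \<open>
  Path regularity is kept apart from the martingale property, because the raw conditional expectations
  of a variable form a martingale whose paths need not be cadlag.
\<close>

definition martingale ::
    "'a measure \<Rightarrow> (real \<Rightarrow> 'a measure) \<Rightarrow> (real \<Rightarrow> 'a \<Rightarrow> real) \<Rightarrow> bool" where
  "martingale P F M \<longleftrightarrow>
     (\<forall>t\<ge>0. M t \<in> borel_measurable (F t)) \<and>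
     (\<forall>t\<ge>0. integrable P (M t)) \<and>
     (\<forall>s\<ge>0. \<forall>t\<ge>s. AE \<omega> in P. real_cond_exp P (F s) (M t) \<omega> = M s \<omega>)"

lemma cadlag_martingale_iff:
  "cadlag_martingale P F M \<longleftrightarrow> martingale P F M \<and> (\<forall>\<omega>\<in>space P. cadlag (\<lambda>t. M t \<omega>))"
  by (auto simp: cadlag_martingale_def martingale_def)

context filtered_prob_space
begin

lemma finite_measure_subalgebra_F: "0 \<le> t \<Longrightarrow> finite_measure_subalgebra P (F t)"
  by (intro finite_measure_subalgebra.intro finite_measure_subalgebra_axioms.intro
      finite_measure_axioms subalg_F)

lemma subalgebra_F_F: "0 \<le> s \<Longrightarrow> s \<le> t \<Longrightarrow> subalgebra (F t) (F s)"
  using subalg_F[of s] subalg_F[of t] mono_F[of s t] by (auto simp: subalgebra_def)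

lemma F_measurableD: "0 \<le> t \<Longrightarrow> f \<in> borel_measurable (F t) \<Longrightarrow> f \<in> borel_measurable P"
  using measurable_from_subalg[OF subalg_F] by blast

lemma F_measurable_mono:
  "0 \<le> s \<Longrightarrow> s \<le> t \<Longrightarrow> f \<in> borel_measurable (F s) \<Longrightarrow> f \<in> borel_measurable (F t)"
  using measurable_from_subalg[OF subalgebra_F_F] by blast

lemma martingale_adapted: "martingale P F M \<Longrightarrow> 0 \<le> t \<Longrightarrow> M t \<in> borel_measurable (F t)"
  and martingale_integrable: "martingale P F M \<Longrightarrow> 0 \<le> t \<Longrightarrow> integrable P (M t)"
  by (auto simp: martingale_def)

lemma martingale_integral_mult:
  assumes M: "martingale P F M" and s: "0 \<le> s" "s \<le> t"
    and h: "h \<in> borel_measurable (F s)" and B: "\<And>\<omega>. \<bar>h \<omega>\<bar> \<le> B"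
  shows "integrable P (\<lambda>\<omega>. h \<omega> * M t \<omega>)"
    and "(\<integral>\<omega>. h \<omega> * M t \<omega> \<partial>P) = (\<integral>\<omega>. h \<omega> * M s \<omega> \<partial>P)"
proof -
  interpret S: finite_measure_subalgebra P "F s"
    using s by (intro finite_measure_subalgebra_F)
  have t: "0 \<le> t" using s by simp
  note [measurable] = F_measurableD[OF s(1) h] F_measurableD[OF s(1) martingale_adapted[OF M s(1)]]
  have hm: "h \<in> borel_measurable P" by measurable
  have Mt: "integrable P (M t)" using M t by (rule martingale_integrable)
  show int: "integrable P (\<lambda>\<omega>. h \<omega> * M t \<omega>)"
  proof (rule Bochner_Integration.integrable_bound)
    show "integrable P (\<lambda>\<omega>. B * M t \<omega>)" using Mt by simp
    show "(\<lambda>\<omega>. h \<omega> * M t \<omega>) \<in> borel_measurable P"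
      using Mt by measurable
    have "0 \<le> B" using B[of undefined] by linarith
    then show "AE \<omega> in P. norm (h \<omega> * M t \<omega>) \<le> norm (B * M t \<omega>)"
      by (auto simp: abs_mult intro!: mult_right_mono B)
  qed
  have "(\<integral>\<omega>. h \<omega> * M t \<omega> \<partial>P) = (\<integral>\<omega>. h \<omega> * real_cond_exp P (F s) (M t) \<omega> \<partial>P)"
    using S.real_cond_exp_intg(2)[OF int h] Mt by auto
  also have "\<dots> = (\<integral>\<omega>. h \<omega> * M s \<omega> \<partial>P)"
  proof (rule integral_cong_AE)
    show "(\<lambda>\<omega>. h \<omega> * real_cond_exp P (F s) (M t) \<omega>) \<in> borel_measurable P"
      using hm by measurable
    show "(\<lambda>\<omega>. h \<omega> * M s \<omega>) \<in> borel_measurable P" by measurable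
    show "AE \<omega> in P. h \<omega> * real_cond_exp P (F s) (M t) \<omega> = h \<omega> * M s \<omega>"
    proof -
      have "AE \<omega> in P. real_cond_exp P (F s) (M t) \<omega> = M s \<omega>"
        using M s unfolding martingale_def by blast
      then show ?thesis by eventually_elim simp
    qed
  qed
  finally show "(\<integral>\<omega>. h \<omega> * M t \<omega> \<partial>P) = (\<integral>\<omega>. h \<omega> * M s \<omega> \<partial>P)" .
qed

lemma cond_exp_integral_mult:
  assumes t: "0 \<le> t" and X: "integrable P X" and N: "N \<in> borel_measurable P"
    and eq: "AE \<omega> in P. real_cond_exp P (F t) X \<omega> = N \<omega>"
    and h: "h \<in> borel_measurable (F t)" and C: "\<And>\<omega>. \<bar>h \<omega>\<bar> \<le> 1"
  shows "(\<integral>\<omega>. h \<omega> * N \<omega> \<partial>P) = (\<integral>\<omega>. h \<omega> * X \<omega> \<partial>P)"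
proof -
  interpret T: finite_measure_subalgebra P "F t" using t by (rule finite_measure_subalgebra_F)
  have [measurable]: "h \<in> borel_measurable P" "X \<in> borel_measurable P" "N \<in> borel_measurable P"
    "real_cond_exp P (F t) X \<in> borel_measurable P"
    using F_measurableD[OF t h] X N F_measurableD[OF t borel_measurable_cond_exp] by auto
  have "integrable P (\<lambda>\<omega>. h \<omega> * X \<omega>)"
  proof (rule Bochner_Integration.integrable_bound[OF X])
    show "AE \<omega> in P. norm (h \<omega> * X \<omega>) \<le> norm (X \<omega>)"
      using mult_right_mono[OF C] by (auto simp: abs_mult)
  qed measurable
  then have "(\<integral>\<omega>. h \<omega> * X \<omega> \<partial>P) = (\<integral>\<omega>. h \<omega> * real_cond_exp P (F t) X \<omega> \<partial>P)"
    using T.real_cond_exp_intg(2)[OF _ h] by auto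
  also have "\<dots> = (\<integral>\<omega>. h \<omega> * N \<omega> \<partial>P)"
  proof (rule integral_cong_AE)
    show "AE \<omega> in P. h \<omega> * real_cond_exp P (F t) X \<omega> = h \<omega> * N \<omega>"
      using eq by eventually_elim simp
  qed measurable
  finally show ?thesis by simp
qed

text \<open>
  Testing \<open>M t\<close> against the factor \<open>indicator A * sgn (M s)\<close>, which is known at time \<open>s\<close>, turns the
  martingale property into this inequality for absolute values.
\<close>

lemma martingale_abs_integral_mono:
  assumes M: "martingale P F M" and s: "0 \<le> s" "s \<le> t" and A: "A \<in> sets (F s)"
  shows "(\<integral>\<omega>. indicator A \<omega> * \<bar>M s \<omega>\<bar> \<partial>P) \<le> (\<integral>\<omega>. indicator A \<omega> * \<bar>M t \<omega>\<bar> \<partial>P)"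
proof -
  define h where "h \<omega> = indicator A \<omega> * sgn (M s \<omega>)" for \<omega>
  have [measurable]: "M s \<in> borel_measurable (F s)" using M s(1) by (rule martingale_adapted)
  have h: "h \<in> borel_measurable (F s)" unfolding h_def using A by measurable
  have h1: "\<bar>h \<omega>\<bar> \<le> 1" for \<omega> by (auto simp: h_def indicator_def sgn_if)
  have AP: "A \<in> sets P" using A subalg_F[OF s(1)] by (auto simp: subalgebra_def)
  have "(\<integral>\<omega>. indicator A \<omega> * \<bar>M s \<omega>\<bar> \<partial>P) = (\<integral>\<omega>. h \<omega> * M s \<omega> \<partial>P)"
    by (intro Bochner_Integration.integral_cong) (auto simp: h_def indicator_def sgn_if)
  also have "\<dots> = (\<integral>\<omega>. h \<omega> * M t \<omega> \<partial>P)"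
    using martingale_integral_mult(2)[OF M s h h1] by simp
  also have "\<dots> \<le> (\<integral>\<omega>. indicator A \<omega> * \<bar>M t \<omega>\<bar> \<partial>P)"
  proof (rule integral_mono)
    show "integrable P (\<lambda>\<omega>. h \<omega> * M t \<omega>)" by (rule martingale_integral_mult(1)[OF M s h h1])
    have "integrable P (\<lambda>\<omega>. \<bar>M t \<omega>\<bar>)" using martingale_integrable[OF M] s by auto
    then show "integrable P (\<lambda>\<omega>. indicator A \<omega> * \<bar>M t \<omega>\<bar>)"
      using integrable_mult_indicator[OF AP] by fastforce
    fix \<omega> show "h \<omega> * M t \<omega> \<le> indicator A \<omega> * \<bar>M t \<omega>\<bar>"
      by (auto simp: h_def indicator_def sgn_if)
  qed
  finally show ?thesis .
qed

end

section \<open>Dyadic times and right-continuous paths\<close>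

definition dyadic_times :: "real set" where
  "dyadic_times = {q. \<exists>(j::nat) (m::nat). q = real j / 2 ^ m}"

text \<open>
  The least multiple of \<open>1 / 2 ^ n\<close> strictly above \<open>t\<close>. It approaches \<open>t\<close> from the right only, so that
  right-continuous paths are recovered from their dyadic values.
\<close>

definition dyadic_above :: "nat \<Rightarrow> real \<Rightarrow> real" where
  "dyadic_above n t = (of_int \<lfloor>t * 2 ^ n\<rfloor> + 1) / 2 ^ n"

lemma countable_dyadic_times: "countable dyadic_times"
proof -
  have "dyadic_times = (\<lambda>(j::nat, m::nat). real j / 2 ^ m) ` UNIV" by (auto simp: dyadic_times_def)
  then show ?thesis by (metis countable_image countableI_type)
qed

lemma dyadic_times_nonneg: "q \<in> dyadic_times \<Longrightarrow> 0 \<le> q"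
  by (auto simp: dyadic_times_def)

lemma dyadic_above_greater: "t < dyadic_above n t"
proof -
  have "t * 2 ^ n < of_int \<lfloor>t * 2 ^ n\<rfloor> + 1" by linarith
  then show ?thesis by (simp add: dyadic_above_def field_simps)
qed

lemma dyadic_above_le: "dyadic_above n t \<le> t + 1 / 2 ^ n"
proof -
  have "of_int \<lfloor>t * 2 ^ n\<rfloor> + 1 \<le> t * 2 ^ n + 1" by linarith
  then show ?thesis by (simp add: dyadic_above_def field_simps)
qed

lemma dyadic_above_dyadic: assumes "0 \<le> t" shows "dyadic_above n t \<in> dyadic_times"
proof -
  have "0 \<le> \<lfloor>t * 2 ^ n\<rfloor>" using assms by simp
  then have "dyadic_above n t = real (nat \<lfloor>t * 2 ^ n\<rfloor> + 1) / 2 ^ n" by (simp add: dyadic_above_def)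
  then show ?thesis unfolding dyadic_times_def by blast
qed

lemma dyadic_above_tendsto: "(\<lambda>n. dyadic_above n t) \<longlonglongrightarrow> t"
proof (rule tendsto_sandwich[where f = "\<lambda>_. t" and h = "\<lambda>n. t + 1 / 2 ^ n"])
  have "(\<lambda>n. t + (1 / 2) ^ n) \<longlonglongrightarrow> t + 0"
    by (intro tendsto_intros LIMSEQ_power_zero) auto
  then show "(\<lambda>n. t + 1 / 2 ^ n) \<longlonglongrightarrow> t" by (simp add: power_divide)
  show "\<forall>\<^sub>F n in sequentially. t \<le> dyadic_above n t"
    by (simp add: dyadic_above_greater less_imp_le)
  show "\<forall>\<^sub>F n in sequentially. dyadic_above n t \<le> t + 1 / 2 ^ n"
    by (simp add: dyadic_above_le)
qed simp

lemma cadlag_dyadic_above_tendsto: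
  assumes "cadlag f" "0 \<le> t"
  shows "(\<lambda>n. f (dyadic_above n t)) \<longlonglongrightarrow> f t"
proof -
  have "(f \<longlongrightarrow> f t) (at_right t)"
    using assms by (auto simp: cadlag_def continuous_within)
  moreover have "filterlim (\<lambda>n. dyadic_above n t) (at_right t) sequentially"
    unfolding filterlim_at
    using dyadic_above_tendsto dyadic_above_greater by (simp add: less_imp_neq[OF dyadic_above_greater, symmetric])
  ultimately show ?thesis by (rule filterlim_compose)
qed

lemma cadlag_abs_le:
  assumes "cadlag f" "\<And>q. q \<in> dyadic_times \<Longrightarrow> \<bar>f q\<bar> \<le> l" "0 \<le> t"
  shows "\<bar>f t\<bar> \<le> l"
proof (rule LIMSEQ_le_const2)
  show "(\<lambda>n. \<bar>f (dyadic_above n t)\<bar>) \<longlonglongrightarrow> \<bar>f t\<bar>"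
    by (intro tendsto_rabs cadlag_dyadic_above_tendsto assms)
qed (use assms dyadic_above_dyadic in auto)

section \<open>The maximal inequality\<close>

text \<open>
  When the event grows by a piece \<open>G\<close> at step \<open>n + 1\<close>, the old part of the bound may be moved from
  \<open>M (\<tau> n)\<close> to \<open>M (\<tau> (Suc n))\<close> by \<open>martingale_abs_integral_mono\<close>, while on \<open>G\<close> the new value exceeds
  \<open>l\<close>. This induction replaces stopping at the first passage.
\<close>

text \<open>
  The event is the increasing union, over \<open>m\<close>, of the events for the grids of mesh \<open>1 / 2 ^ m\<close> on
  \<open>[0, m]\<close>. For cadlag paths it controls all times, by \<open>cadlag_abs_le\<close>.
\<close>

lemma (in filtered_prob_space) maximal_inequality_grid:
  fixes \<tau> :: "nat \<Rightarrow> real"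
  assumes M: "martingale P F M" and \<tau>: "mono \<tau>" "\<And>k. 0 \<le> \<tau> k" and l: "0 \<le> l"
  defines "E \<equiv> \<lambda>n. {\<omega> \<in> space P. \<exists>k\<le>n. l < \<bar>M (\<tau> k) \<omega>\<bar>}"
  shows "E n \<in> sets (F (\<tau> n)) \<and>
    l * measure P (E n) \<le> (\<integral>\<omega>. indicator (E n) \<omega> * \<bar>M (\<tau> n) \<omega>\<bar> \<partial>P)"
proof (induction n)
  have sp: "space (F (\<tau> k)) = space P" for k
    using subalg_F[OF \<tau>(2)] by (auto simp: subalgebra_def)
  have subP: "A \<in> sets (F (\<tau> k)) \<Longrightarrow> A \<in> sets P" for A k
    using subalg_F[OF \<tau>(2)] by (auto simp: subalgebra_def)
  have G_sets: "{\<omega> \<in> space P. l < \<bar>M (\<tau> k) \<omega>\<bar>} \<in> sets (F (\<tau> k))" for k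
  proof -
    have [measurable]: "M (\<tau> k) \<in> borel_measurable (F (\<tau> k))"
      using M \<tau>(2) by (rule martingale_adapted)
    show ?thesis unfolding sp[of k, symmetric] by measurable
  qed
  have int: "A \<in> sets P \<Longrightarrow> integrable P (\<lambda>\<omega>. indicator A \<omega> * \<bar>M (\<tau> k) \<omega>\<bar>)" for A k
    using integrable_mult_indicator[of A P "\<lambda>\<omega>. \<bar>M (\<tau> k) \<omega>\<bar>"]
      martingale_integrable[OF M \<tau>(2)] by auto
  have level: "l * measure P A \<le> (\<integral>\<omega>. indicator A \<omega> * \<bar>M (\<tau> k) \<omega>\<bar> \<partial>P)"
    if A: "A \<in> sets P" "A \<subseteq> {\<omega> \<in> space P. l < \<bar>M (\<tau> k) \<omega>\<bar>}" for A k
  proof -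
    have "l * measure P A = (\<integral>\<omega>. indicator A \<omega> * l \<partial>P)"
      using A(1) by simp
    also have "\<dots> \<le> (\<integral>\<omega>. indicator A \<omega> * \<bar>M (\<tau> k) \<omega>\<bar> \<partial>P)"
    proof (rule integral_mono)
      show "integrable P (\<lambda>\<omega>. indicator A \<omega> * l)"
        using A(1) by (intro integrable_mult_left integrable_real_indicator) (simp_all add: less_top[symmetric])
      show "integrable P (\<lambda>\<omega>. indicator A \<omega> * \<bar>M (\<tau> k) \<omega>\<bar>)" by (rule int[OF A(1)])
      show "indicator A \<omega> * l \<le> indicator A \<omega> * \<bar>M (\<tau> k) \<omega>\<bar>" for \<omega>
        using A(2) by (cases "\<omega> \<in> A") (auto simp: less_imp_le)
    qed
    finally show ?thesis .
  qed
  {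
    case 0
    have "E 0 = {\<omega> \<in> space P. l < \<bar>M (\<tau> 0) \<omega>\<bar>}" by (auto simp: E_def)
    moreover have "E 0 \<in> sets (F (\<tau> 0))" unfolding calculation by (rule G_sets)
    ultimately show ?case using level[OF subP] by blast
  next
    case (Suc n)
    define G where "G = {\<omega> \<in> space P. l < \<bar>M (\<tau> (Suc n)) \<omega>\<bar>} - E n"
    have n: "\<tau> n \<le> \<tau> (Suc n)" using \<tau>(1) by (simp add: monoD)
    have En: "E n \<in> sets (F (\<tau> (Suc n)))" using Suc mono_F[OF \<tau>(2) n] by auto
    have G: "G \<in> sets (F (\<tau> (Suc n)))" unfolding G_def using G_sets En by blast
    have un: "E (Suc n) = E n \<union> G" "E n \<inter> G = {}"
      by (auto simp: E_def G_def le_Suc_eq)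
    have "l * measure P (E (Suc n)) = l * measure P (E n) + l * measure P G"
      using finite_measure_Union[OF subP[OF En] subP[OF G] un(2)]
      by (simp add: un(1) algebra_simps)
    also have "\<dots> \<le> (\<integral>\<omega>. indicator (E n) \<omega> * \<bar>M (\<tau> n) \<omega>\<bar> \<partial>P) +
        (\<integral>\<omega>. indicator G \<omega> * \<bar>M (\<tau> (Suc n)) \<omega>\<bar> \<partial>P)"
    proof (rule add_mono)
      show "l * measure P G \<le> (\<integral>\<omega>. indicator G \<omega> * \<bar>M (\<tau> (Suc n)) \<omega>\<bar> \<partial>P)"
        using subP[OF G] by (rule level) (auto simp: G_def)
    qed (use Suc in simp)
    also have "\<dots> \<le> (\<integral>\<omega>. indicator (E n) \<omega> * \<bar>M (\<tau> (Suc n)) \<omega>\<bar> \<partial>P) +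
        (\<integral>\<omega>. indicator G \<omega> * \<bar>M (\<tau> (Suc n)) \<omega>\<bar> \<partial>P)"
      using martingale_abs_integral_mono[OF M \<tau>(2) n, of "E n"] Suc by simp
    also have "\<dots> = (\<integral>\<omega>. indicator (E (Suc n)) \<omega> * \<bar>M (\<tau> (Suc n)) \<omega>\<bar> \<partial>P)"
    proof (subst Bochner_Integration.integral_add[symmetric])
      show "(\<integral>\<omega>. indicator (E n) \<omega> * \<bar>M (\<tau> (Suc n)) \<omega>\<bar> +
          indicator G \<omega> * \<bar>M (\<tau> (Suc n)) \<omega>\<bar> \<partial>P) =
        (\<integral>\<omega>. indicator (E (Suc n)) \<omega> * \<bar>M (\<tau> (Suc n)) \<omega>\<bar> \<partial>P)"
        using un by (intro Bochner_Integration.integral_cong) (auto simp: indicator_def)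
    qed (intro int subP[OF En] subP[OF G])+
    finally show ?case using sets.Un[OF En G] un(1) by simp
  }
qed

lemma (in filtered_prob_space) maximal_inequality:
  assumes M: "martingale P F M" and l: "0 < l"
    and C: "\<And>t. 0 \<le> t \<Longrightarrow> (\<integral>\<omega>. \<bar>M t \<omega>\<bar> \<partial>P) \<le> C"
  defines "E \<equiv> {\<omega> \<in> space P. \<exists>q\<in>dyadic_times. l < \<bar>M q \<omega>\<bar>}"
  shows "E \<in> sets P" and "measure P E \<le> C / l"
proof -
  define A where "A m = {\<omega> \<in> space P. \<exists>k\<le>m * 2 ^ m. l < \<bar>M (real k / 2 ^ m) \<omega>\<bar>}" for m :: nat
  have \<tau>: "mono (\<lambda>k. real k / 2 ^ m)" for m :: nat by (auto simp: mono_def divide_right_mono)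
  have A: "A m \<in> sets P" "measure P (A m) \<le> C / l" for m
  proof -
    note * = maximal_inequality_grid[OF M \<tau>[of m], of l "m * 2 ^ m", folded A_def]
    show AP: "A m \<in> sets P"
      using * l subalg_F[of "real (m * 2 ^ m) / 2 ^ m"] by (auto simp: subalgebra_def)
    have int: "integrable P (\<lambda>\<omega>. \<bar>M (real m) \<omega>\<bar>)" using martingale_integrable[OF M] by auto
    have "l * measure P (A m) \<le> (\<integral>\<omega>. indicator (A m) \<omega> * \<bar>M (real m) \<omega>\<bar> \<partial>P)"
      using * l by simp
    also have "\<dots> \<le> (\<integral>\<omega>. \<bar>M (real m) \<omega>\<bar> \<partial>P)"
      using integrable_mult_indicator[OF AP int]
      by (intro integral_mono int) (auto simp: indicator_def)
    also have "\<dots> \<le> C" by (rule C) simp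
    finally show "measure P (A m) \<le> C / l" using l by (simp add: field_simps)
  qed
  have "incseq A"
  proof (rule incseq_SucI, rule subsetI)
    fix m \<omega> assume "\<omega> \<in> A m"
    then obtain k where k: "\<omega> \<in> space P" "k \<le> m * 2 ^ m" "l < \<bar>M (real k / 2 ^ m) \<omega>\<bar>"
      by (auto simp: A_def)
    have "2 * k \<le> Suc m * 2 ^ Suc m" using k(2) by simp
    moreover have "l < \<bar>M (real (2 * k) / 2 ^ Suc m) \<omega>\<bar>" using k(3) by simp
    ultimately show "\<omega> \<in> A (Suc m)" using k(1) unfolding A_def by blast
  qed
  moreover have EA: "E = (\<Union>m. A m)"
  proof (intro equalityI subsetI)
    fix \<omega> assume "\<omega> \<in> E"
    then obtain j n where jn: "\<omega> \<in> space P" "l < \<bar>M (real j / 2 ^ n) \<omega>\<bar>"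
      by (auto simp: E_def dyadic_times_def)
    define m where "m = n + j"
    have "real (j * 2 ^ j) / 2 ^ m = real j / 2 ^ n" by (simp add: m_def power_add)
    moreover have "j * 2 ^ j \<le> m * 2 ^ m" unfolding m_def
      by (intro mult_mono power_increasing) auto
    ultimately have "\<exists>k\<le>m * 2 ^ m. l < \<bar>M (real k / 2 ^ m) \<omega>\<bar>"
      using jn(2) by (intro exI[of _ "j * 2 ^ j"]) simp
    then have "\<omega> \<in> A m" using jn(1) unfolding A_def by blast
    then show "\<omega> \<in> (\<Union>m. A m)" by blast
  qed (auto simp: A_def E_def dyadic_times_def)
  ultimately have "(\<lambda>m. measure P (A m)) \<longlonglongrightarrow> measure P E"
    using finite_Lim_measure_incseq[of A] A(1) by (simp add: image_subset_iff)
  then show "measure P E \<le> C / l" by (rule LIMSEQ_le_const2) (use A in auto)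
  show "E \<in> sets P" using A(1) by (auto simp: EA)
qed

section \<open>Uniformly integrable martingales are Cauchy in the mean\<close>

lemma uniformly_integrable_tail:
  assumes ui: "uniformly_integrable P I X" and e: "0 < e"
    and int: "\<And>i. i \<in> I \<Longrightarrow> integrable P (X i)"
  obtains K where "0 < K"
    "\<And>i. i \<in> I \<Longrightarrow> (\<integral>\<omega>. \<bar>X i \<omega>\<bar> * indicator {\<omega>. K \<le> \<bar>X i \<omega>\<bar>} \<omega> \<partial>P) \<le> e"
proof -
  define tail where
    "tail K i = (\<integral>\<^sup>+\<omega>\<in>{\<omega>. K \<le> \<bar>X i \<omega>\<bar>}. ennreal \<bar>X i \<omega>\<bar> \<partial>P)" for K i
  have "((\<lambda>K. SUP i\<in>I. tail K i) \<longlongrightarrow> 0) at_top"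
    using ui by (simp add: uniformly_integrable_def tail_def)
  then have "eventually (\<lambda>K. (SUP i\<in>I. tail K i) < ennreal e) at_top"
    using e by (intro order_tendstoD) auto
  then have "eventually (\<lambda>K. 0 < K \<and> (SUP i\<in>I. tail K i) < ennreal e) at_top"
    using eventually_gt_at_top[of 0] by eventually_elim auto
  then obtain K where K: "0 < K" "(SUP i\<in>I. tail K i) < ennreal e"
    using eventually_happens'[OF trivial_limit_at_top_linorder] by blast
  show thesis
  proof
    fix i assume i: "i \<in> I"
    have [measurable]: "X i \<in> borel_measurable P" using int[OF i] by simp
    have ind: "(\<lambda>\<omega>. \<bar>X i \<omega>\<bar> * indicator {\<omega>. K \<le> \<bar>X i \<omega>\<bar>} \<omega>) \<in> borel_measurable P"
      unfolding indicator_def by measurable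
    have "integrable P (\<lambda>\<omega>. \<bar>X i \<omega>\<bar> * indicator {\<omega>. K \<le> \<bar>X i \<omega>\<bar>} \<omega>)"
      by (rule Bochner_Integration.integrable_bound[OF int[OF i] ind]) (auto simp: indicator_def)
    then have "ennreal (\<integral>\<omega>. \<bar>X i \<omega>\<bar> * indicator {\<omega>. K \<le> \<bar>X i \<omega>\<bar>} \<omega> \<partial>P) =
        (\<integral>\<^sup>+\<omega>. ennreal (\<bar>X i \<omega>\<bar> * indicator {\<omega>. K \<le> \<bar>X i \<omega>\<bar>} \<omega>) \<partial>P)"
      by (intro nn_integral_eq_integral[symmetric]) auto
    also have "\<dots> = tail K i"
      unfolding tail_def by (intro nn_integral_cong) (auto simp: indicator_def)
    also have "\<dots> \<le> (SUP i\<in>I. tail K i)" using i by (rule SUP_upper)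
    also have "\<dots> < ennreal e" by (rule K)
    finally show "(\<integral>\<omega>. \<bar>X i \<omega>\<bar> * indicator {\<omega>. K \<le> \<bar>X i \<omega>\<bar>} \<omega> \<partial>P) \<le> e"
      using e by (simp add: ennreal_less_iff)
  qed (rule K)
qed

text \<open>
  The amount by which the convex function \<open>sqrt (1 + x\<^sup>2)\<close> lies above its tangent at \<open>x\<close>, evaluated
  at \<open>y\<close>. The function has linear growth, so that it stays integrable along a martingale that is
  merely bounded in \<open>L\<^sup>1\<close>, and bounded slope, so that the tangent term has mean zero.
\<close>

definition bregman :: "real \<Rightarrow> real \<Rightarrow> real" where
  "bregman y x = sqrt (1 + y\<^sup>2) - sqrt (1 + x\<^sup>2) - x / sqrt (1 + x\<^sup>2) * (y - x)"

text \<open>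
  With \<open>a = sqrt (1 + x\<^sup>2)\<close> and \<open>b = sqrt (1 + y\<^sup>2)\<close> the divergence is \<open>(a b - 1 - x y) / a\<close>, and
  \<open>(a b)\<^sup>2 - (1 + x y)\<^sup>2 = (y - x)\<^sup>2\<close>; both claims follow by factoring this difference of squares.
\<close>

lemma bregman_nonneg: "0 \<le> bregman y x"
  and bregman_quadratic:
    "\<bar>x\<bar> \<le> K \<Longrightarrow> \<bar>y\<bar> \<le> K \<Longrightarrow> (y - x)\<^sup>2 \<le> 2 * (1 + K) ^ 3 * bregman y x"
proof -
  define a where "a = sqrt (1 + x\<^sup>2)"
  define b where "b = sqrt (1 + y\<^sup>2)"
  have a: "a\<^sup>2 = 1 + x\<^sup>2" "1 \<le> a" and b: "b\<^sup>2 = 1 + y\<^sup>2" "1 \<le> b"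
    by (auto simp: a_def b_def)
  have D: "a * bregman y x = a * b - (1 + x * y)"
  proof -
    have "a * bregman y x = a * b - a\<^sup>2 - x * (y - x)"
      using a(2) unfolding bregman_def a_def[symmetric] b_def[symmetric]
      by (simp add: field_simps power2_eq_square)
    then show ?thesis by (simp add: a(1)) (simp add: algebra_simps power2_eq_square)
  qed
  have sq: "(a * b)\<^sup>2 = (1 + x * y)\<^sup>2 + (y - x)\<^sup>2"
    unfolding power_mult_distrib a(1) b(1) by (simp add: algebra_simps power2_eq_square)
  have ab: "\<bar>1 + x * y\<bar> \<le> a * b"
  proof (rule power2_le_imp_le)
    show "\<bar>1 + x * y\<bar>\<^sup>2 \<le> (a * b)\<^sup>2" using sq by simp
    show "0 \<le> a * b" using a(2) b(2) by simp
  qed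
  have "0 \<le> a * bregman y x" using ab D by linarith
  then show nn: "0 \<le> bregman y x" using a(2) by (simp add: zero_le_mult_iff)
  assume K: "\<bar>x\<bar> \<le> K" "\<bar>y\<bar> \<le> K"
  have "x\<^sup>2 \<le> K\<^sup>2" "y\<^sup>2 \<le> K\<^sup>2" using K by (auto simp: abs_le_square_iff[symmetric])
  then have L: "a \<le> 1 + K" "b \<le> 1 + K"
    using K unfolding a_def b_def by (auto intro!: real_le_lsqrt simp: power2_sum)
  have ab2: "a * b \<le> (1 + K) * (1 + K)" using L a(2) b(2) by (intro mult_mono) auto
  have "(y - x)\<^sup>2 = (a * b - (1 + x * y)) * (a * b + (1 + x * y))"
    using sq by (simp add: algebra_simps power2_eq_square)
  also have "\<dots> = bregman y x * (a * (a * b + (1 + x * y)))" by (simp add: D[symmetric])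
  also have "\<dots> \<le> bregman y x * ((1 + K) * (2 * ((1 + K) * (1 + K))))"
    using ab ab2 L a(2) by (intro mult_left_mono mult_mono nn) linarith+
  finally show "(y - x)\<^sup>2 \<le> 2 * (1 + K) ^ 3 * bregman y x"
    by (simp add: power3_eq_cube algebra_simps)
qed

text \<open>
  Splits a distance into a part controlled by the divergence, for values below \<open>K\<close>, and a part
  controlled by the tails that uniform integrability makes small.
\<close>

lemma abs_diff_le_bregman:
  fixes x y K d :: real
  assumes d: "0 < d" and K: "0 < K"
  shows "\<bar>y - x\<bar> \<le> d + 2 * (1 + K) ^ 3 / d * bregman y x +
    2 * (\<bar>x\<bar> * indicator {x. K \<le> \<bar>x\<bar>} x + \<bar>y\<bar> * indicator {x. K \<le> \<bar>x\<bar>} y)"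
proof -
  have nn: "0 \<le> 2 * (1 + K) ^ 3 / d * bregman y x" using d K bregman_nonneg[of y x] by simp
  show ?thesis
  proof (cases "\<bar>x\<bar> < K \<and> \<bar>y\<bar> < K")
    case True
    have "\<bar>y - x\<bar> \<le> d + (y - x)\<^sup>2 / d"
    proof (cases "\<bar>y - x\<bar> \<le> d")
      case False
      then have "\<bar>y - x\<bar> * d \<le> \<bar>y - x\<bar> * \<bar>y - x\<bar>" by (intro mult_left_mono) auto
      then have "\<bar>y - x\<bar> \<le> (y - x)\<^sup>2 / d" using d by (simp add: field_simps power2_eq_square)
      then show ?thesis using d by linarith
    qed (use d in \<open>auto intro: add_increasing2\<close>)
    also have "(y - x)\<^sup>2 / d \<le> 2 * (1 + K) ^ 3 / d * bregman y x"
      using bregman_quadratic[of x K y] True d by (simp add: divide_right_mono)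
    finally show ?thesis using True by simp
  next
    case False
    then have "\<bar>y - x\<bar> \<le> 2 * (\<bar>x\<bar> * indicator {x. K \<le> \<bar>x\<bar>} x + \<bar>y\<bar> * indicator {x. K \<le> \<bar>x\<bar>} y)"
      using K by (auto simp: indicator_def)
    then show ?thesis using nn d by linarith
  qed
qed

context filtered_prob_space
begin

text \<open>
  The expectation \<open>g t\<close> of \<open>sqrt (1 + (M t)\<^sup>2)\<close> is bounded in \<open>t\<close>, and \<open>g t - g s\<close> is the expected
  Bregman divergence of \<open>M t\<close> from \<open>M s\<close>. Hence that divergence is small for every \<open>t\<close> after a time
  \<open>s\<close> at which \<open>g\<close> is close to its supremum.
\<close>

lemma ui_martingale_L1_Cauchy:
  assumes M: "martingale P F M" and ui: "uniformly_integrable P {0..} M" and e: "0 < e"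
  shows "\<exists>s\<ge>0. \<forall>t\<ge>s. (\<integral>\<omega>. \<bar>M t \<omega> - M s \<omega>\<bar> \<partial>P) \<le> e"
proof -
  have int: "integrable P (M t)" if "0 \<le> t" for t using martingale_integrable[OF M that] .
  \<comment> \<open>Two tails, each with factor 2, enter the estimate: together they cost a third of \<open>e\<close>.\<close>
  obtain K where K: "0 < K" and tail: "\<And>t. 0 \<le> t \<Longrightarrow>
      (\<integral>\<omega>. \<bar>M t \<omega>\<bar> * indicator {\<omega>. K \<le> \<bar>M t \<omega>\<bar>} \<omega> \<partial>P) \<le> e / 12"
  proof (rule uniformly_integrable_tail[OF ui, of "e / 12"])
    show "0 < e / 12" using e by simp
    show "integrable P (M t)" if "t \<in> {0..}" for t using int that by simp
  qed simp
  define T where "T t \<omega> = \<bar>M t \<omega>\<bar> * indicator {x. K \<le> \<bar>x\<bar>} (M t \<omega>)" for t \<omega>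
  have T_int: "integrable P (T t)" if "0 \<le> t" for t
  proof (rule Bochner_Integration.integrable_bound[OF int[OF that]])
    have [measurable]: "M t \<in> borel_measurable P" using int[OF that] by simp
    show "T t \<in> borel_measurable P" unfolding T_def indicator_def by measurable
  qed (auto simp: T_def indicator_def)
  have T_le: "(\<integral>\<omega>. T t \<omega> \<partial>P) \<le> e / 12" if "0 \<le> t" for t
    using tail[OF that] by (simp add: T_def[abs_def] indicator_def)
  define g where "g t = (\<integral>\<omega>. sqrt (1 + (M t \<omega>)\<^sup>2) \<partial>P)" for t
  have sqrt_le: "sqrt (1 + x\<^sup>2) \<le> 1 + \<bar>x\<bar>" for x :: real
    by (intro real_le_lsqrt) (auto simp: power2_sum)
  have g_int: "integrable P (\<lambda>\<omega>. sqrt (1 + (M t \<omega>)\<^sup>2))" if "0 \<le> t" for t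
  proof (rule Bochner_Integration.integrable_bound)
    show "integrable P (\<lambda>\<omega>. 1 + \<bar>M t \<omega>\<bar>)" using int[OF that] by auto
    have [measurable]: "M t \<in> borel_measurable P" using int[OF that] by simp
    show "(\<lambda>\<omega>. sqrt (1 + (M t \<omega>)\<^sup>2)) \<in> borel_measurable P" by measurable
  qed (use sqrt_le in auto)
  have g_le: "g t \<le> 1 + K + e / 12" if t: "0 \<le> t" for t
  proof -
    have "g t \<le> (\<integral>\<omega>. 1 + K + T t \<omega> \<partial>P)" unfolding g_def
    proof (rule integral_mono)
      fix \<omega>
      show "sqrt (1 + (M t \<omega>)\<^sup>2) \<le> 1 + K + T t \<omega>"
        using sqrt_le[of "M t \<omega>"] K by (auto simp: T_def indicator_def)
    qed (use g_int T_int t in auto)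
    also have "\<dots> = 1 + K + (\<integral>\<omega>. T t \<omega> \<partial>P)" using T_int[OF t] by (simp add: prob_space)
    finally show ?thesis using T_le[OF t] by linarith
  qed
  \<comment> \<open>The slope \<open>h\<close> of the tangent at \<open>M s\<close> is bounded and known at time \<open>s\<close>,
    so the tangent term integrates to zero.\<close>
  have est: "(\<integral>\<omega>. \<bar>M t \<omega> - M s \<omega>\<bar> \<partial>P) \<le> d + 2 * (1 + K) ^ 3 / d * (g t - g s) + e / 3"
    if st: "0 \<le> s" "s \<le> t" and d: "0 < d" for s t d
  proof -
    have t: "0 \<le> t" using st by simp
    define h where "h \<omega> = M s \<omega> / sqrt (1 + (M s \<omega>)\<^sup>2)" for \<omega>
    have [measurable]: "M s \<in> borel_measurable (F s)" using M st(1) by (rule martingale_adapted)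
    have h: "h \<in> borel_measurable (F s)" unfolding h_def by measurable
    have h1: "\<bar>h \<omega>\<bar> \<le> 1" for \<omega>
    proof -
      have "\<bar>M s \<omega>\<bar> \<le> sqrt (1 + (M s \<omega>)\<^sup>2)" by (intro real_le_rsqrt) simp
      moreover have "0 < sqrt (1 + (M s \<omega>)\<^sup>2)" by (simp add: add_pos_nonneg)
      ultimately show ?thesis by (simp add: h_def abs_divide)
    qed
    note hM = martingale_integral_mult[OF M st(1) _ h h1]
    have br: "bregman (M t \<omega>) (M s \<omega>) =
        sqrt (1 + (M t \<omega>)\<^sup>2) - sqrt (1 + (M s \<omega>)\<^sup>2) - h \<omega> * M t \<omega> + h \<omega> * M s \<omega>" for \<omega>
      by (simp add: bregman_def h_def algebra_simps diff_divide_distrib)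
    note ints = g_int[OF t] g_int[OF st(1)] hM(1)[OF st(2)] hM(1)[OF order_refl] T_int[OF t] T_int[OF st(1)]
    have br_int: "integrable P (\<lambda>\<omega>. bregman (M t \<omega>) (M s \<omega>))"
      unfolding br using ints by auto
    have br_eq: "(\<integral>\<omega>. bregman (M t \<omega>) (M s \<omega>) \<partial>P) = g t - g s"
      unfolding br g_def using ints hM(2)[OF st(2)] by simp
    have "(\<integral>\<omega>. \<bar>M t \<omega> - M s \<omega>\<bar> \<partial>P) \<le>
        (\<integral>\<omega>. d + 2 * (1 + K) ^ 3 / d * bregman (M t \<omega>) (M s \<omega>) + 2 * (T s \<omega> + T t \<omega>) \<partial>P)"
    proof (rule integral_mono)
      show "integrable P (\<lambda>\<omega>. \<bar>M t \<omega> - M s \<omega>\<bar>)" using int[OF t] int[OF st(1)] by auto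
      show "integrable P (\<lambda>\<omega>. d + 2 * (1 + K) ^ 3 / d * bregman (M t \<omega>) (M s \<omega>) + 2 * (T s \<omega> + T t \<omega>))"
        using ints br_int by auto
      show "\<bar>M t \<omega> - M s \<omega>\<bar> \<le> d + 2 * (1 + K) ^ 3 / d * bregman (M t \<omega>) (M s \<omega>) + 2 * (T s \<omega> + T t \<omega>)" for \<omega>
        using abs_diff_le_bregman[OF d K, of "M t \<omega>" "M s \<omega>"] by (simp add: T_def)
    qed
    also have "\<dots> = d + 2 * (1 + K) ^ 3 / d * (g t - g s) + 2 * ((\<integral>\<omega>. T s \<omega> \<partial>P) + (\<integral>\<omega>. T t \<omega> \<partial>P))"
      using ints br_int by (simp add: br_eq prob_space)
    also have "\<dots> \<le> d + 2 * (1 + K) ^ 3 / d * (g t - g s) + e / 3"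
      using add_mono[OF T_le[OF st(1)] T_le[OF t]] by simp
    finally show ?thesis .
  qed
  define d where "d = e / 3"
  define C where "C = 2 * (1 + K) ^ 3 / d"
  have d: "0 < d" and C: "0 < C" using e K by (auto simp: d_def C_def)
  have bdd: "bdd_above (g ` {0..})" using g_le by (auto simp: bdd_above_def)
  have "Sup (g ` {0..}) - d / C < Sup (g ` {0..})" using d C by simp
  then obtain s where s: "0 \<le> s" "Sup (g ` {0..}) - d / C < g s"
    using less_cSup_iff[OF _ bdd] by auto
  show ?thesis
  proof (intro exI[of _ s] conjI allI impI s(1))
    fix t assume t: "s \<le> t"
    have "g t \<le> Sup (g ` {0..})" using t s(1) by (intro cSup_upper bdd) auto
    then have "C * (g t - g s) \<le> C * (d / C)" using s(2) C by (intro mult_left_mono) auto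
    then have "C * (g t - g s) \<le> d" using C by simp
    then show "(\<integral>\<omega>. \<bar>M t \<omega> - M s \<omega>\<bar> \<partial>P) \<le> e"
      using est[OF s(1) t d, folded C_def] d_def by linarith
  qed
qed

end

section \<open>The terminal value of a uniformly integrable martingale\<close>

lemma real_cauchy_filter_convergent:
  fixes f :: "'b \<Rightarrow> real"
  assumes "G \<noteq> bot"
    and "\<And>e. 0 < e \<Longrightarrow> \<exists>Q. eventually Q G \<and> (\<forall>x y. Q x \<and> Q y \<longrightarrow> \<bar>f x - f y\<bar> < e)"
  shows "\<exists>l. (f \<longlongrightarrow> l) G"
proof -
  have "cauchy_filter (filtermap f G)"
    using assms(2) unfolding cauchy_filter_metric_filtermap by (simp add: dist_real_def)
  then have "convergent_filter (filtermap f G)" by (rule cauchy_filter_convergent)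
  then show ?thesis by (simp add: convergent_filter_iff filterlim_def)
qed

lemma (in filtered_prob_space) filtered_prob_space_shift:
  "0 \<le> s \<Longrightarrow> filtered_prob_space P (\<lambda>t. F (s + t))"
  using subalg_F mono_F by unfold_locales simp_all

lemma (in filtered_prob_space) martingale_shift_diff:
  assumes M: "martingale P F M" and s: "0 \<le> s"
  shows "martingale P (\<lambda>t. F (s + t)) (\<lambda>t \<omega>. M (s + t) \<omega> - M s \<omega>)"
  unfolding martingale_def
proof (intro conjI allI impI)
  have Ms: "M s \<in> borel_measurable (F s)" "integrable P (M s)"
    using martingale_adapted[OF M s] martingale_integrable[OF M s] by auto
  {
    fix t :: real assume t: "0 \<le> t"
    show "(\<lambda>\<omega>. M (s + t) \<omega> - M s \<omega>) \<in> borel_measurable (F (s + t))"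
      using martingale_adapted[OF M, of "s + t"] F_measurable_mono[OF s _ Ms(1), of "s + t"] s t
      by (intro borel_measurable_diff) auto
    show "integrable P (\<lambda>\<omega>. M (s + t) \<omega> - M s \<omega>)"
      using martingale_integrable[OF M, of "s + t"] Ms(2) s t by auto
  }
  fix r t :: real assume rt: "0 \<le> r" "r \<le> t"
  interpret R: finite_measure_subalgebra P "F (s + r)"
    using s rt by (intro finite_measure_subalgebra_F) auto
  have int: "integrable P (M (s + t))" using martingale_integrable[OF M, of "s + t"] s rt by auto
  have "M s \<in> borel_measurable (F (s + r))"
    using F_measurable_mono[OF s _ Ms(1), of "s + r"] rt by simp
  then have "AE \<omega> in P. real_cond_exp P (F (s + r)) (M s) \<omega> = M s \<omega>"
    by (rule R.real_cond_exp_F_meas[OF Ms(2)])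
  moreover have "AE \<omega> in P. real_cond_exp P (F (s + r)) (M (s + t)) \<omega> = M (s + r) \<omega>"
    using M s rt by (simp add: martingale_def)
  moreover note R.real_cond_exp_diff[OF int Ms(2)]
  ultimately show "AE \<omega> in P. real_cond_exp P (F (s + r)) (\<lambda>\<omega>. M (s + t) \<omega> - M s \<omega>) \<omega> =
      M (s + r) \<omega> - M s \<omega>"
    by eventually_elim simp
qed

lemma cadlag_shift_diff:
  assumes f: "cadlag f" and s: "0 \<le> s"
  shows "cadlag (\<lambda>t. f (s + t) - c)"
  unfolding cadlag_def
proof (intro conjI allI impI)
  fix t :: real assume t: "0 \<le> t"
  have "(f \<longlongrightarrow> f (s + t)) (at_right (s + t))"
    using f s t by (auto simp: cadlag_def continuous_within)
  then have "((\<lambda>x. f (s + x)) \<longlongrightarrow> f (s + t)) (at_right t)"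
    by (simp add: filterlim_at_right_to_0[of _ _ "s + t"] filterlim_at_right_to_0[of _ _ t] ac_simps)
  then show "continuous (at_right t) (\<lambda>t. f (s + t) - c)"
    by (auto simp: continuous_within intro!: tendsto_intros)
next
  fix t :: real assume t: "0 < t"
  have "0 < s + t" using s t by simp
  then obtain l where l: "(f \<longlongrightarrow> l) (at_left (s + t))"
    using f unfolding cadlag_def by blast
  have "filterlim (\<lambda>x. s + x) (at_left (s + t)) (at_left t)"
    unfolding filterlim_at by (auto intro!: tendsto_intros simp: eventually_at_filter)
  then have "((\<lambda>x. f (s + x) - c) \<longlongrightarrow> l - c) (at_left t)"
    by (intro tendsto_diff tendsto_const filterlim_compose[OF l])
  then show "\<exists>l. ((\<lambda>x. f (s + x) - c) \<longlongrightarrow> l) (at_left t)" by blast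
qed

text \<open>
  The maximal inequality for the increments after time \<open>s\<close> bounds the probability that
  the path ever moves by more than \<open>l\<close> after \<open>s\<close>. Choosing \<open>s\<close> by \<open>ui_martingale_L1_Cauchy\<close> makes it
  arbitrarily small, so almost every path is Cauchy at infinity.
\<close>

lemma (in filtered_prob_space) cadlag_ui_martingale_converges:
  assumes M: "martingale P F M" and cad: "\<And>\<omega>. \<omega> \<in> space P \<Longrightarrow> cadlag (\<lambda>t. M t \<omega>)"
    and ui: "uniformly_integrable P {0..} M"
  shows "AE \<omega> in P. \<exists>l. ((\<lambda>t. M t \<omega>) \<longlongrightarrow> l) at_top"
proof -
  have osc: "AE \<omega> in P. \<exists>s\<ge>0. \<forall>t\<ge>0. \<bar>M (s + t) \<omega> - M s \<omega>\<bar> \<le> l" if l: "0 < l" for l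
  proof -
    have "\<exists>s\<ge>0. \<forall>t\<ge>s. (\<integral>\<omega>. \<bar>M t \<omega> - M s \<omega>\<bar> \<partial>P) \<le> l / Suc i" for i
      using l by (intro ui_martingale_L1_Cauchy[OF M ui]) simp
    then obtain s where s: "\<And>i. 0 \<le> s i"
      "\<And>i t. s i \<le> t \<Longrightarrow> (\<integral>\<omega>. \<bar>M t \<omega> - M (s i) \<omega>\<bar> \<partial>P) \<le> l / Suc i"
      by metis
    define E where
      "E i = {\<omega> \<in> space P. \<exists>q\<in>dyadic_times. l < \<bar>M (s i + q) \<omega> - M (s i) \<omega>\<bar>}" for i
    have E: "E i \<in> sets P" "measure P (E i) \<le> 1 / Suc i" for i
    proof -
      interpret S: filtered_prob_space P "\<lambda>t. F (s i + t)" by (rule filtered_prob_space_shift[OF s(1)])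
      have C: "(\<integral>\<omega>. \<bar>M (s i + t) \<omega> - M (s i) \<omega>\<bar> \<partial>P) \<le> l / Suc i" if "0 \<le> t" for t
        using that by (intro s(2)) simp
      note * = S.maximal_inequality[OF martingale_shift_diff[OF M s(1)[of i]] l C, folded E_def]
      show "E i \<in> sets P" using *(1) .
      show "measure P (E i) \<le> 1 / Suc i" using *(2) l by simp
    qed
    have "measure P (\<Inter>i. E i) \<le> 1 / Suc i" for i
      using E(1) by (intro order_trans[OF finite_measure_mono E(2)[of i]]) auto
    moreover have "(\<lambda>i. 1 / Suc i) \<longlonglongrightarrow> (0::real)"
      using LIMSEQ_inverse_real_of_nat by (simp add: inverse_eq_divide)
    ultimately have "measure P (\<Inter>i. E i) \<le> 0"
      by (intro LIMSEQ_le_const) auto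
    moreover have "(\<Inter>i. E i) \<in> sets P" using E(1) by auto
    ultimately have "AE \<omega> in P. \<omega> \<notin> (\<Inter>i. E i)"
      by (intro AE_not_in null_setsI) (auto simp: emeasure_eq_measure measure_le_0_iff)
    then show ?thesis using AE_space
    proof eventually_elim
      fix \<omega> assume \<omega>: "\<omega> \<notin> (\<Inter>i. E i)" "\<omega> \<in> space P"
      then obtain i where i: "\<omega> \<notin> E i" by auto
      have q: "\<bar>M (s i + q) \<omega> - M (s i) \<omega>\<bar> \<le> l" if "q \<in> dyadic_times" for q
        using i \<omega>(2) that by (force simp: E_def)
      have "\<bar>M (s i + t) \<omega> - M (s i) \<omega>\<bar> \<le> l" if "0 \<le> t" for t
        using cadlag_shift_diff[OF cad[OF \<omega>(2)] s(1)] q that by (rule cadlag_abs_le)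
      then show "\<exists>s\<ge>0. \<forall>t\<ge>0. \<bar>M (s + t) \<omega> - M s \<omega>\<bar> \<le> l" using s(1) by blast
    qed
  qed
  have "AE \<omega> in P. \<forall>j::nat. \<exists>s\<ge>0. \<forall>t\<ge>0. \<bar>M (s + t) \<omega> - M s \<omega>\<bar> \<le> 1 / Suc j"
    by (subst AE_all_countable) (auto intro!: osc)
  then show ?thesis
  proof eventually_elim
    fix \<omega> assume *: "\<forall>j::nat. \<exists>s\<ge>0. \<forall>t\<ge>0. \<bar>M (s + t) \<omega> - M s \<omega>\<bar> \<le> 1 / Suc j"
    show "\<exists>l. ((\<lambda>t. M t \<omega>) \<longlongrightarrow> l) at_top"
    proof (rule real_cauchy_filter_convergent)
      fix e :: real assume e: "0 < e"
      then obtain j where "inverse (real (Suc j)) < e / 2" using reals_Archimedean[of "e / 2"] by auto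
      then have j: "1 / Suc j < e / 2" by (simp add: inverse_eq_divide)
      obtain s where s: "\<And>t. 0 \<le> t \<Longrightarrow> \<bar>M (s + t) \<omega> - M s \<omega>\<bar> \<le> 1 / Suc j" using * by blast
      have s': "\<bar>M t \<omega> - M s \<omega>\<bar> < e / 2" if "s \<le> t" for t
        using s[of "t - s"] that j by simp
      show "\<exists>Q. eventually Q at_top \<and> (\<forall>x y. Q x \<and> Q y \<longrightarrow> \<bar>M x \<omega> - M y \<omega>\<bar> < e)"
      proof (intro exI[of _ "\<lambda>t. s \<le> t"] conjI allI impI eventually_ge_at_top)
        fix x y assume "s \<le> x \<and> s \<le> y"
        then show "\<bar>M x \<omega> - M y \<omega>\<bar> < e" using s'[of x] s'[of y] by linarith
      qed
    qed simp
  qed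
qed

text \<open>
  Completeness makes changes on null sets harmless for adaptedness. Almost sure limits along the
  filtration are therefore adapted, whatever value they take where the limit fails to exist.
\<close>

locale complete_filtered_prob_space = filtered_prob_space +
  assumes null_sets_complete: "N \<in> null_sets P \<Longrightarrow> A \<subseteq> N \<Longrightarrow> A \<in> sets (F 0)"
begin

lemma F_measurable_AE_eq:
  fixes f g :: "'a \<Rightarrow> real"
  assumes t: "0 \<le> t" and g: "g \<in> borel_measurable (F t)" and eq: "AE \<omega> in P. f \<omega> = g \<omega>"
  shows "f \<in> borel_measurable (F t)"
proof -
  have sp: "space (F t) = space P" using subalg_F[OF t] by (auto simp: subalgebra_def)
  obtain N where N: "N \<in> null_sets P" "{\<omega> \<in> space P. f \<omega> \<noteq> g \<omega>} \<subseteq> N"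
    using eq by (auto elim!: AE_E simp: null_sets_def)
  have null: "A \<in> sets (F t)" if "A \<subseteq> {\<omega> \<in> space P. f \<omega> \<noteq> g \<omega>}" for A
    using null_sets_complete[OF N(1), of A] that N(2) mono_F[OF order_refl t] by blast
  show ?thesis
  proof (rule measurableI)
    fix B :: "real set" assume B: "B \<in> sets borel"
    define D where "D = {\<omega> \<in> space P. f \<omega> \<noteq> g \<omega>}"
    have "f -` B \<inter> space (F t) = ((g -` B \<inter> space (F t)) - D) \<union> (f -` B \<inter> D)"
      by (auto simp: D_def sp)
    also have "\<dots> \<in> sets (F t)"
      using measurable_sets[OF g B] null[of D] null[of "f -` B \<inter> D"] by (auto simp: D_def)
    finally show "f -` B \<inter> space (F t) \<in> sets (F t)" .
  qed simp
qed

lemma measurable_AE_eq: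
  fixes f g :: "'a \<Rightarrow> real"
  assumes g: "g \<in> borel_measurable P" and eq: "AE \<omega> in P. f \<omega> = g \<omega>"
  shows "f \<in> borel_measurable P"
proof -
  interpret C: complete_filtered_prob_space P "\<lambda>_. P"
    by unfold_locales (use null_sets_complete subalg_F[of 0] in \<open>auto simp: subalgebra_def\<close>)
  show ?thesis using C.F_measurable_AE_eq[OF order_refl g eq] .
qed

text \<open>
  By Fatou's lemma along integer times, the \<open>L\<^sup>1\<close> Cauchy estimate passes to the pathwise limit.
\<close>

lemma ui_martingale_terminal_limit:
  assumes "ui_martingale P F M"
  shows "AE \<omega> in P. ((\<lambda>t. M t \<omega>) \<longlongrightarrow> terminal_value M \<omega>) at_top"
proof -
  have "AE \<omega> in P. \<exists>l. ((\<lambda>t. M t \<omega>) \<longlongrightarrow> l) at_top"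
    using assms by (intro cadlag_ui_martingale_converges) (auto simp: ui_martingale_def cadlag_martingale_iff)
  then show ?thesis
  proof eventually_elim
    fix \<omega> assume "\<exists>l. ((\<lambda>t. M t \<omega>) \<longlongrightarrow> l) at_top"
    then obtain l where l: "((\<lambda>t. M t \<omega>) \<longlongrightarrow> l) at_top" by blast
    then have "terminal_value M \<omega> = l"
      unfolding terminal_value_def by (intro tendsto_Lim) simp
    with l show "((\<lambda>t. M t \<omega>) \<longlongrightarrow> terminal_value M \<omega>) at_top" by simp
  qed
qed

lemma ui_martingale_terminal_measurable:
  assumes M: "ui_martingale P F M"
  shows "terminal_value M \<in> borel_measurable P"
proof (rule measurable_AE_eq)
  have [measurable]: "M (real n) \<in> borel_measurable P" for n
    using M by (intro F_measurableD[of "real n"] martingale_adapted)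
      (auto simp: ui_martingale_def cadlag_martingale_iff)
  show "(\<lambda>\<omega>. lim (\<lambda>n. M (real n) \<omega>)) \<in> borel_measurable P" by measurable
  show "AE \<omega> in P. terminal_value M \<omega> = lim (\<lambda>n. M (real n) \<omega>)"
    using ui_martingale_terminal_limit[OF M]
  proof eventually_elim
    fix \<omega> assume "((\<lambda>t. M t \<omega>) \<longlongrightarrow> terminal_value M \<omega>) at_top"
    then have "(\<lambda>n. M (real n) \<omega>) \<longlonglongrightarrow> terminal_value M \<omega>"
      by (rule filterlim_compose[OF _ filterlim_real_sequentially])
    then show "terminal_value M \<omega> = lim (\<lambda>n. M (real n) \<omega>)" by (simp add: limI)
  qed
qed

lemma ui_martingale_terminal:
  assumes M: "ui_martingale P F M"
  shows "integrable P (terminal_value M)"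
    and "\<And>e. 0 < e \<Longrightarrow> \<exists>s\<ge>0. \<forall>t\<ge>s. (\<integral>\<omega>. \<bar>terminal_value M \<omega> - M t \<omega>\<bar> \<partial>P) \<le> e"
proof -
  let ?T = "terminal_value M"
  have mart: "martingale P F M" and ui: "uniformly_integrable P {0..} M"
    using M by (auto simp: ui_martingale_def cadlag_martingale_iff)
  have int: "integrable P (M t)" if "0 \<le> t" for t using martingale_integrable[OF mart that] .
  have [measurable]: "M t \<in> borel_measurable P" if "0 \<le> t" for t using int[OF that] by simp
  have [measurable]: "?T \<in> borel_measurable P" by (rule ui_martingale_terminal_measurable[OF M])
  have fatou: "(\<integral>\<^sup>+\<omega>. ennreal \<bar>?T \<omega> - M s \<omega>\<bar> \<partial>P) \<le> ennreal e"
    if s: "0 \<le> s" and e: "0 < e" "\<And>t. s \<le> t \<Longrightarrow> (\<integral>\<omega>. \<bar>M t \<omega> - M s \<omega>\<bar> \<partial>P) \<le> e" for s e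
  proof -
    have "(\<integral>\<^sup>+\<omega>. ennreal \<bar>?T \<omega> - M s \<omega>\<bar> \<partial>P) =
        (\<integral>\<^sup>+\<omega>. liminf (\<lambda>n. ennreal \<bar>M (s + real n) \<omega> - M s \<omega>\<bar>) \<partial>P)"
    proof (rule nn_integral_cong_AE)
      show "AE \<omega> in P. ennreal \<bar>?T \<omega> - M s \<omega>\<bar> = liminf (\<lambda>n. ennreal \<bar>M (s + real n) \<omega> - M s \<omega>\<bar>)"
        using ui_martingale_terminal_limit[OF M]
      proof eventually_elim
        fix \<omega> assume *: "((\<lambda>t. M t \<omega>) \<longlongrightarrow> ?T \<omega>) at_top"
        have "filterlim (\<lambda>n. s + real n) at_top sequentially"
          by (intro filterlim_tendsto_add_at_top[OF tendsto_const] filterlim_real_sequentially)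
        then have "(\<lambda>n. M (s + real n) \<omega>) \<longlonglongrightarrow> ?T \<omega>"
          by (rule filterlim_compose[OF *])
        then have "(\<lambda>n. ennreal \<bar>M (s + real n) \<omega> - M s \<omega>\<bar>) \<longlonglongrightarrow> ennreal \<bar>?T \<omega> - M s \<omega>\<bar>"
          by (intro tendsto_ennrealI tendsto_rabs tendsto_diff tendsto_const)
        then show "ennreal \<bar>?T \<omega> - M s \<omega>\<bar> = liminf (\<lambda>n. ennreal \<bar>M (s + real n) \<omega> - M s \<omega>\<bar>)"
          by (intro lim_imp_Liminf[symmetric]) auto
      qed
    qed
    also have "\<dots> \<le> liminf (\<lambda>n. \<integral>\<^sup>+\<omega>. ennreal \<bar>M (s + real n) \<omega> - M s \<omega>\<bar> \<partial>P)"
      using s by (intro nn_integral_liminf) measurable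
    also have "\<dots> \<le> liminf (\<lambda>n. ennreal e)"
    proof (intro Liminf_mono always_eventually allI)
      fix n
      have "integrable P (\<lambda>\<omega>. M (s + real n) \<omega> - M s \<omega>)"
        using s by (intro Bochner_Integration.integrable_diff int) auto
      then have "(\<integral>\<^sup>+\<omega>. ennreal \<bar>M (s + real n) \<omega> - M s \<omega>\<bar> \<partial>P) =
          ennreal (\<integral>\<omega>. \<bar>M (s + real n) \<omega> - M s \<omega>\<bar> \<partial>P)"
        by (intro nn_integral_eq_integral) auto
      also have "\<dots> \<le> ennreal e" using e(2)[of "s + real n"] by (intro ennreal_leI) auto
      finally show "(\<integral>\<^sup>+\<omega>. ennreal \<bar>M (s + real n) \<omega> - M s \<omega>\<bar> \<partial>P) \<le> ennreal e" .
    qed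
    finally show ?thesis by (simp add: Liminf_const)
  qed
  obtain s where s: "0 \<le> s" "\<And>t. s \<le> t \<Longrightarrow> (\<integral>\<omega>. \<bar>M t \<omega> - M s \<omega>\<bar> \<partial>P) \<le> 1"
    using ui_martingale_L1_Cauchy[OF mart ui, of 1] by auto
  have "integrable P (\<lambda>\<omega>. ?T \<omega> - M s \<omega>)"
    using fatou[OF s(1) zero_less_one s(2)] s(1)
    by (intro integrableI_bounded) (auto intro: le_less_trans)
  from Bochner_Integration.integrable_add[OF this int[OF s(1)]]
  show T_int: "integrable P ?T" by simp
  fix e :: real assume e: "0 < e"
  then obtain s where s: "0 \<le> s" "\<And>t. s \<le> t \<Longrightarrow> (\<integral>\<omega>. \<bar>M t \<omega> - M s \<omega>\<bar> \<partial>P) \<le> e / 2"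
    using ui_martingale_L1_Cauchy[OF mart ui, of "e / 2"] by auto
  show "\<exists>s\<ge>0. \<forall>t\<ge>s. (\<integral>\<omega>. \<bar>?T \<omega> - M t \<omega>\<bar> \<partial>P) \<le> e"
  proof (intro exI[of _ s] conjI allI impI s(1))
    fix t assume t: "s \<le> t"
    have Ts: "(\<integral>\<omega>. \<bar>?T \<omega> - M s \<omega>\<bar> \<partial>P) \<le> e / 2"
    proof -
      have "ennreal (\<integral>\<omega>. \<bar>?T \<omega> - M s \<omega>\<bar> \<partial>P) = (\<integral>\<^sup>+\<omega>. ennreal \<bar>?T \<omega> - M s \<omega>\<bar> \<partial>P)"
        using T_int int[OF s(1)] by (intro nn_integral_eq_integral[symmetric]) auto
      also have "\<dots> \<le> ennreal (e / 2)" using e s by (intro fatou) auto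
      finally show ?thesis using e by (simp add: ennreal_le_iff)
    qed
    have "(\<integral>\<omega>. \<bar>?T \<omega> - M t \<omega>\<bar> \<partial>P) \<le> (\<integral>\<omega>. \<bar>?T \<omega> - M s \<omega>\<bar> + \<bar>M t \<omega> - M s \<omega>\<bar> \<partial>P)"
      using T_int int[OF s(1)] int[of t] s(1) t by (intro integral_mono) auto
    also have "\<dots> = (\<integral>\<omega>. \<bar>?T \<omega> - M s \<omega>\<bar> \<partial>P) + (\<integral>\<omega>. \<bar>M t \<omega> - M s \<omega>\<bar> \<partial>P)"
      using T_int int[OF s(1)] int[of t] s(1) t by (intro Bochner_Integration.integral_add) auto
    finally show "(\<integral>\<omega>. \<bar>?T \<omega> - M t \<omega>\<bar> \<partial>P) \<le> e" using Ts s(2)[OF t] by linarith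
  qed
qed

text \<open>
  The martingale property lets \<open>M s\<close> be replaced by \<open>M t\<close> for late \<open>t\<close>, which is close to the terminal
  value in \<open>L\<^sup>1\<close>. Taking indicators for \<open>h\<close> says that the terminal value has conditional expectation
  \<open>M s\<close> at time \<open>s\<close>.
\<close>

lemma ui_martingale_closed:
  assumes M: "ui_martingale P F M" and s: "0 \<le> s"
    and h: "h \<in> borel_measurable (F s)" and B: "\<And>\<omega>. \<bar>h \<omega>\<bar> \<le> B"
  shows "(\<integral>\<omega>. h \<omega> * terminal_value M \<omega> \<partial>P) = (\<integral>\<omega>. h \<omega> * M s \<omega> \<partial>P)"
proof -
  let ?T = "terminal_value M"
  have mart: "martingale P F M" using M by (auto simp: ui_martingale_def cadlag_martingale_iff)
  have B0: "0 \<le> B" using B[of undefined] by linarith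
  have [measurable]: "h \<in> borel_measurable P" using F_measurableD[OF s h] .
  have T_int: "integrable P ?T" by (rule ui_martingale_terminal(1)[OF M])
  have hint: "integrable P (\<lambda>\<omega>. h \<omega> * f \<omega>)" if "integrable P f" for f
  proof (rule Bochner_Integration.integrable_bound)
    show "integrable P (\<lambda>\<omega>. B * f \<omega>)" using that by simp
    show "(\<lambda>\<omega>. h \<omega> * f \<omega>) \<in> borel_measurable P" using that by measurable
    show "AE \<omega> in P. norm (h \<omega> * f \<omega>) \<le> norm (B * f \<omega>)"
      using B0 by (auto simp: abs_mult intro!: mult_right_mono B)
  qed
  have "\<bar>(\<integral>\<omega>. h \<omega> * ?T \<omega> \<partial>P) - (\<integral>\<omega>. h \<omega> * M s \<omega> \<partial>P)\<bar> \<le> B * e" if e: "0 < e" for e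
  proof -
    obtain r where r: "0 \<le> r" "\<And>t. r \<le> t \<Longrightarrow> (\<integral>\<omega>. \<bar>?T \<omega> - M t \<omega>\<bar> \<partial>P) \<le> e"
      using ui_martingale_terminal(2)[OF M e] by auto
    define t where "t = max r s"
    have t: "r \<le> t" "s \<le> t" "0 \<le> t" using r s by (auto simp: t_def)
    have Mt: "integrable P (M t)" using martingale_integrable[OF mart t(3)] .
    have "\<bar>(\<integral>\<omega>. h \<omega> * ?T \<omega> \<partial>P) - (\<integral>\<omega>. h \<omega> * M s \<omega> \<partial>P)\<bar> =
        \<bar>(\<integral>\<omega>. h \<omega> * ?T \<omega> \<partial>P) - (\<integral>\<omega>. h \<omega> * M t \<omega> \<partial>P)\<bar>"
      using martingale_integral_mult(2)[OF mart s t(2) h B] by simp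
    also have "\<dots> = \<bar>\<integral>\<omega>. h \<omega> * ?T \<omega> - h \<omega> * M t \<omega> \<partial>P\<bar>"
      using hint[OF T_int] hint[OF Mt] by simp
    also have "\<dots> \<le> (\<integral>\<omega>. \<bar>h \<omega> * ?T \<omega> - h \<omega> * M t \<omega>\<bar> \<partial>P)" by (rule integral_abs_bound)
    also have "\<dots> \<le> (\<integral>\<omega>. B * \<bar>?T \<omega> - M t \<omega>\<bar> \<partial>P)"
    proof (rule integral_mono)
      fix \<omega>
      have "\<bar>h \<omega> * ?T \<omega> - h \<omega> * M t \<omega>\<bar> = \<bar>h \<omega>\<bar> * \<bar>?T \<omega> - M t \<omega>\<bar>"
        by (simp add: abs_mult[symmetric] algebra_simps)
      also have "\<dots> \<le> B * \<bar>?T \<omega> - M t \<omega>\<bar>" by (intro mult_right_mono B) simp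
      finally show "\<bar>h \<omega> * ?T \<omega> - h \<omega> * M t \<omega>\<bar> \<le> B * \<bar>?T \<omega> - M t \<omega>\<bar>" .
    qed (use hint[OF T_int] hint[OF Mt] T_int Mt in auto)
    also have "\<dots> \<le> B * e" using r(2)[OF t(1)] B0 by (simp add: mult_left_mono)
    finally show ?thesis .
  qed
  note * = this
  have "\<bar>(\<integral>\<omega>. h \<omega> * ?T \<omega> \<partial>P) - (\<integral>\<omega>. h \<omega> * M s \<omega> \<partial>P)\<bar> \<le> 0"
  proof (rule field_le_epsilon)
    fix e :: real assume e: "0 < e"
    have "B * (e / (B + 1)) \<le> e" using B0 e by (simp add: field_simps)
    then show "\<bar>(\<integral>\<omega>. h \<omega> * ?T \<omega> \<partial>P) - (\<integral>\<omega>. h \<omega> * M s \<omega> \<partial>P)\<bar> \<le> 0 + e"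
      using *[of "e / (B + 1)"] e B0 by simp
  qed
  then show ?thesis by simp
qed

end

section \<open>Counting the jumps of a path along a finite grid\<close>

text \<open>
  The value of the path at its last jump: a jump occurs, and moves the anchor, as soon as the path is
  at distance at least \<open>e\<close> from the anchor.
\<close>

fun anchor :: "real \<Rightarrow> (nat \<Rightarrow> real) \<Rightarrow> nat \<Rightarrow> real" where
  "anchor e y 0 = y 0"
| "anchor e y (Suc n) = (if e \<le> \<bar>y (Suc n) - anchor e y n\<bar> then y (Suc n) else anchor e y n)"

fun jumps :: "real \<Rightarrow> (nat \<Rightarrow> real) \<Rightarrow> nat \<Rightarrow> nat" where
  "jumps e y 0 = 0"
| "jumps e y (Suc n) = (if e \<le> \<bar>y (Suc n) - anchor e y n\<bar> then Suc (jumps e y n) else jumps e y n)"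

lemma jumps_mono: "m \<le> n \<Longrightarrow> jumps e y m \<le> jumps e y n"
  by (rule lift_Suc_mono_le[of "jumps e y"]) auto

lemma jumps_le: "jumps e y n \<le> n"
  by (induction n) auto

lemma anchor_close: "0 < e \<Longrightarrow> \<bar>y n - anchor e y n\<bar> < e"
  by (induction n) auto

lemma anchor_unchanged: "a \<le> b \<Longrightarrow> jumps e y b = jumps e y a \<Longrightarrow> anchor e y b = anchor e y a"
proof (induction b rule: dec_induct)
  case (step n)
  have "jumps e y a \<le> jumps e y n" using step by (intro jumps_mono) simp
  with step show ?case by (auto split: if_splits)
qed simp

text \<open>
  Without a jump between \<open>a\<close> and \<open>b\<close>, both values lie within \<open>e\<close> of the same anchor.
\<close>

lemma jumps_increase:
  assumes e: "0 < e" and ab: "a \<le> b" and d: "2 * e \<le> \<bar>y a - y b\<bar>"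
  shows "jumps e y a < jumps e y b"
proof (rule ccontr)
  assume "\<not> ?thesis"
  then have "jumps e y b = jumps e y a" using jumps_mono[OF ab, of e y] by simp
  then have "anchor e y b = anchor e y a" by (rule anchor_unchanged[OF ab])
  then show False using anchor_close[OF e, of y a] anchor_close[OF e, of y b] d by linarith
qed

text \<open>
  Writing \<open>Z\<close> for the values on the grid and \<open>A\<close> for the anchor, the quantity
  \<open>V = e\<^sup>2 N + (Z - A)\<^sup>2\<close> has expectation at most \<open>E Z\<^sup>2\<close> at every step. A jump resets the second term from
  at least \<open>e\<^sup>2\<close> to zero and adds exactly \<open>e\<^sup>2\<close> to the first, so it cannot increase \<open>V\<close>. Otherwise \<open>V\<close>
  changes with \<open>(Z - A)\<^sup>2\<close>, whose expectation grows as that of \<open>Z\<^sup>2\<close>, since the anchor is known before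
  the increment occurs.
\<close>

lemma (in filtered_prob_space) expected_jumps_le:
  fixes \<tau> :: "nat \<Rightarrow> real"
  assumes Y: "martingale P F Y" and B: "\<And>t \<omega>. 0 \<le> t \<Longrightarrow> \<bar>Y t \<omega>\<bar> \<le> B"
    and \<tau>: "mono \<tau>" "\<And>k. 0 \<le> \<tau> k" and e: "0 < e"
  defines "N \<equiv> \<lambda>n \<omega>. real (jumps e (\<lambda>k. Y (\<tau> k) \<omega>) n)"
  shows "N n \<in> borel_measurable P" and "(\<integral>\<omega>. N n \<omega> \<partial>P) \<le> B\<^sup>2 / e\<^sup>2"
proof -
  define A where "A n \<omega> = anchor e (\<lambda>k. Y (\<tau> k) \<omega>) n" for n \<omega>
  define Z where "Z n = Y (\<tau> n)" for n
  have Z_F: "Z n \<in> borel_measurable (F (\<tau> n))" for n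
    unfolding Z_def by (rule martingale_adapted[OF Y \<tau>(2)])
  have meas: "A n \<in> borel_measurable (F (\<tau> n)) \<and> N n \<in> borel_measurable (F (\<tau> n))" for n
  proof (induction n)
    case 0
    then show ?case using Z_F[of 0] by (simp add: A_def[abs_def] N_def Z_def)
  next
    case (Suc n)
    have n: "\<tau> n \<le> \<tau> (Suc n)" using \<tau>(1) by (simp add: monoD)
    have [measurable]: "A n \<in> borel_measurable (F (\<tau> (Suc n)))" "N n \<in> borel_measurable (F (\<tau> (Suc n)))"
      using Suc F_measurable_mono[OF \<tau>(2) n] by auto
    have [measurable]: "Z (Suc n) \<in> borel_measurable (F (\<tau> (Suc n)))" by (rule Z_F)
    have "A (Suc n) = (\<lambda>\<omega>. if e \<le> \<bar>Z (Suc n) \<omega> - A n \<omega>\<bar> then Z (Suc n) \<omega> else A n \<omega>)"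
      by (auto simp: A_def Z_def)
    moreover have "N (Suc n) = (\<lambda>\<omega>. if e \<le> \<bar>Z (Suc n) \<omega> - A n \<omega>\<bar> then N n \<omega> + 1 else N n \<omega>)"
      by (auto simp: A_def Z_def N_def)
    ultimately show ?case by simp
  qed
  have [measurable]: "A n \<in> borel_measurable P" "N n \<in> borel_measurable P" "Z n \<in> borel_measurable P" for n
    using meas[of n] Z_F[of n] F_measurableD[OF \<tau>(2)] by auto
  show "N n \<in> borel_measurable P" by measurable
  have ZB: "\<bar>Z n \<omega>\<bar> \<le> B" for n \<omega> unfolding Z_def by (rule B[OF \<tau>(2)])
  have AB: "\<bar>A n \<omega>\<bar> \<le> B" for n \<omega>
    by (induction n) (use ZB in \<open>auto simp: A_def Z_def\<close>)
  have B0: "0 \<le> B" using ZB[of undefined undefined] by linarith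
  have int: "integrable P (\<lambda>\<omega>. f \<omega>)" if "f \<in> borel_measurable P" "\<And>\<omega>. \<bar>f \<omega>\<bar> \<le> C" for f and C :: real
    using that by (intro integrable_const_bound[of _ C]) auto
  have N_int: "integrable P (N n)" for n
  proof (rule int[of _ "real n"])
    show "N n \<in> borel_measurable P" by measurable
    show "\<bar>N n \<omega>\<bar> \<le> real n" for \<omega> by (simp add: N_def jumps_le)
  qed
  have Z2_int: "integrable P (\<lambda>\<omega>. (Z n \<omega>)\<^sup>2)" for n
    by (rule int[of _ "B\<^sup>2"]) (use ZB in \<open>auto simp: abs_le_square_iff[symmetric] B0\<close>)
  have AZ_int: "integrable P (\<lambda>\<omega>. A n \<omega> * Z m \<omega>)" for n m
    by (rule int[of _ "B * B"]) (use ZB AB in \<open>auto simp: abs_mult intro!: mult_mono B0\<close>)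
  have A2_int: "integrable P (\<lambda>\<omega>. (A n \<omega>)\<^sup>2)" for n
    by (rule int[of _ "B\<^sup>2"]) (use AB in \<open>auto simp: abs_le_square_iff[symmetric] B0\<close>)
  \<comment> \<open>The square is multiplied out because the martingale property acts on the mixed term only.\<close>
  define V where "V n \<omega> = e\<^sup>2 * N n \<omega> + ((Z n \<omega>)\<^sup>2 - 2 * (A n \<omega> * Z n \<omega>) + (A n \<omega>)\<^sup>2)" for n \<omega>
  have V_int: "integrable P (V n)" for n
    unfolding V_def using N_int Z2_int AZ_int A2_int by auto
  have V_sq: "V n \<omega> = e\<^sup>2 * N n \<omega> + (Z n \<omega> - A n \<omega>)\<^sup>2" for n \<omega>
    by (simp add: V_def power2_eq_square algebra_simps)
  have "(\<integral>\<omega>. V n \<omega> \<partial>P) \<le> (\<integral>\<omega>. (Z n \<omega>)\<^sup>2 \<partial>P)"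
  proof (induction n)
    case 0
    have "V 0 = (\<lambda>_. 0)" by (auto simp: V_sq N_def A_def Z_def)
    then show ?case by simp
  next
    case (Suc n)
    have n: "\<tau> n \<le> \<tau> (Suc n)" using \<tau>(1) by (simp add: monoD)
    have orth: "(\<integral>\<omega>. A n \<omega> * Z (Suc n) \<omega> \<partial>P) = (\<integral>\<omega>. A n \<omega> * Z n \<omega> \<partial>P)"
      unfolding Z_def using meas[of n] AB by (intro martingale_integral_mult(2)[OF Y \<tau>(2) n]) auto
    have "(\<integral>\<omega>. V (Suc n) \<omega> \<partial>P) \<le> (\<integral>\<omega>. V n \<omega> + ((Z (Suc n) \<omega>)\<^sup>2 - (Z n \<omega>)\<^sup>2) -
        2 * (A n \<omega> * Z (Suc n) \<omega> - A n \<omega> * Z n \<omega>) \<partial>P)"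
    proof (rule integral_mono)
      fix \<omega>
      have "V (Suc n) \<omega> \<le> e\<^sup>2 * N n \<omega> + (Z (Suc n) \<omega> - A n \<omega>)\<^sup>2"
      proof (cases "e \<le> \<bar>Z (Suc n) \<omega> - A n \<omega>\<bar>")
        case True
        then have "e\<^sup>2 \<le> (Z (Suc n) \<omega> - A n \<omega>)\<^sup>2"
          using e by (simp add: abs_le_square_iff[symmetric])
        with True show ?thesis unfolding V_sq by (simp add: N_def A_def Z_def algebra_simps)
      next
        case False
        then show ?thesis unfolding V_sq by (simp add: N_def A_def Z_def)
      qed
      then show "V (Suc n) \<omega> \<le> V n \<omega> + ((Z (Suc n) \<omega>)\<^sup>2 - (Z n \<omega>)\<^sup>2) -
          2 * (A n \<omega> * Z (Suc n) \<omega> - A n \<omega> * Z n \<omega>)"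
        by (simp add: V_def power2_eq_square algebra_simps)
    qed (use V_int Z2_int AZ_int in auto)
    also have "\<dots> = (\<integral>\<omega>. V n \<omega> \<partial>P) + ((\<integral>\<omega>. (Z (Suc n) \<omega>)\<^sup>2 \<partial>P) - (\<integral>\<omega>. (Z n \<omega>)\<^sup>2 \<partial>P))"
      using V_int Z2_int AZ_int by (simp add: orth)
    finally show ?case using Suc by linarith
  qed
  moreover have "e\<^sup>2 * (\<integral>\<omega>. N n \<omega> \<partial>P) \<le> (\<integral>\<omega>. V n \<omega> \<partial>P)"
  proof -
    have "e\<^sup>2 * (\<integral>\<omega>. N n \<omega> \<partial>P) = (\<integral>\<omega>. e\<^sup>2 * N n \<omega> \<partial>P)" by simp
    also have "\<dots> \<le> (\<integral>\<omega>. V n \<omega> \<partial>P)"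
    proof (rule integral_mono)
      show "integrable P (\<lambda>\<omega>. e\<^sup>2 * N n \<omega>)" using N_int by simp
      show "integrable P (V n)" by (rule V_int)
    qed (simp add: V_sq)
    finally show ?thesis .
  qed
  moreover have "(\<integral>\<omega>. (Z n \<omega>)\<^sup>2 \<partial>P) \<le> B\<^sup>2"
  proof -
    have "(\<integral>\<omega>. (Z n \<omega>)\<^sup>2 \<partial>P) \<le> (\<integral>\<omega>. B\<^sup>2 \<partial>P)"
      using Z2_int ZB B0 by (intro integral_mono) (auto simp: abs_le_square_iff[symmetric])
    then show ?thesis by (simp add: prob_space)
  qed
  ultimately show "(\<integral>\<omega>. N n \<omega> \<partial>P) \<le> B\<^sup>2 / e\<^sup>2" using e by (simp add: field_simps)
qed

section \<open>Paths of finite oscillation have one-sided limits\<close>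

text \<open>
  Jumps up to time \<open>t\<close> along the grid of mesh \<open>1 / 2 ^ m\<close>.
\<close>

definition grid_jumps :: "real \<Rightarrow> (real \<Rightarrow> real) \<Rightarrow> nat \<Rightarrow> real \<Rightarrow> nat" where
  "grid_jumps e y m t = jumps e (\<lambda>k. y (real k / 2 ^ m)) (nat \<lfloor>t * 2 ^ m\<rfloor>)"

text \<open>
  The greedy jump count need not be monotone in the mesh, so boundedness is only required along
  infinitely many grids; this is the form that Fatou's lemma delivers. The horizon \<open>m\<close> grows with
  the fineness, so that one condition covers all times.
\<close>

definition finite_oscillation :: "(real \<Rightarrow> real) \<Rightarrow> bool" where
  "finite_oscillation y \<longleftrightarrow>
     (\<forall>i::nat. \<exists>R. \<exists>\<^sub>F m in sequentially. grid_jumps (1 / Suc i) y m (real m) \<le> R)"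

lemma grid_jumps_mono: "s \<le> t \<Longrightarrow> grid_jumps e y m s \<le> grid_jumps e y m t"
  unfolding grid_jumps_def by (intro jumps_mono nat_mono floor_mono mult_right_mono) auto

text \<open>
  Two dyadic times lie on all sufficiently fine grids.
\<close>

lemma grid_jumps_increase:
  assumes e: "0 < e" and q: "a \<in> dyadic_times" "b \<in> dyadic_times" "a \<le> b"
    and d: "2 * e \<le> \<bar>y a - y b\<bar>"
  shows "\<forall>\<^sub>F m in sequentially. grid_jumps e y m a < grid_jumps e y m b"
proof -
  have on_grid: "\<forall>\<^sub>F m in sequentially. real (nat \<lfloor>c * 2 ^ m\<rfloor>) / 2 ^ m = c"
    if "c \<in> dyadic_times" for c
  proof -
    obtain j n where c: "c = real j / 2 ^ n" using \<open>c \<in> dyadic_times\<close> unfolding dyadic_times_def by blast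
    show ?thesis using eventually_ge_at_top[of n]
    proof eventually_elim
      fix m assume "n \<le> m"
      then obtain k where "m = n + k" by (auto simp: le_iff_add)
      then have "c * 2 ^ m = real (j * 2 ^ k)" unfolding c by (simp add: power_add)
      then show "real (nat \<lfloor>c * 2 ^ m\<rfloor>) / 2 ^ m = c" by (simp only: floor_of_nat nat_int) (simp add: field_simps)
    qed
  qed
  show ?thesis using on_grid[OF q(1)] on_grid[OF q(2)]
  proof eventually_elim
    fix m assume "real (nat \<lfloor>a * 2 ^ m\<rfloor>) / 2 ^ m = a" "real (nat \<lfloor>b * 2 ^ m\<rfloor>) / 2 ^ m = b"
    moreover have "nat \<lfloor>a * 2 ^ m\<rfloor> \<le> nat \<lfloor>b * 2 ^ m\<rfloor>"
      using q(3) by (intro nat_mono floor_mono mult_right_mono) auto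
    ultimately show "grid_jumps e y m a < grid_jumps e y m b"
      unfolding grid_jumps_def using d by (intro jumps_increase[OF e]) auto
  qed
qed

text \<open>
  Otherwise there are pairs of dyadic times with distant values arbitrarily close to \<open>t\<close> on its right.
  Any number of disjoint such pairs can be lined up, each forcing a jump on all fine grids.
\<close>

lemma finite_oscillation_right:
  assumes y: "finite_oscillation y" and e: "0 < e"
  shows "\<exists>d>0. \<forall>a\<in>dyadic_times \<inter> {t<..<t + d}. \<forall>b\<in>dyadic_times \<inter> {t<..<t + d}. \<bar>y a - y b\<bar> < e"
proof (rule ccontr)
  assume neg: "\<not> ?thesis"
  obtain i where "inverse (real (Suc i)) < e / 2" using reals_Archimedean[of "e / 2"] e by auto
  then have i: "2 * (1 / Suc i) \<le> e" by (simp add: inverse_eq_divide)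
  have pair: "\<exists>a b. a \<in> dyadic_times \<and> b \<in> dyadic_times \<and> t < a \<and> a \<le> b \<and> b < v \<and> e \<le> \<bar>y a - y b\<bar>"
    if "t < v" for v
  proof -
    obtain a b where ab: "a \<in> dyadic_times" "b \<in> dyadic_times" "t < a" "t < b" "a < v" "b < v"
      "e \<le> \<bar>y a - y b\<bar>"
      using neg \<open>t < v\<close> by (auto simp: not_less dest!: spec[of _ "v - t"])
    show ?thesis
    proof (cases "a \<le> b")
      case True
      then show ?thesis using ab by blast
    next
      case False
      then have "b \<le> a" "e \<le> \<bar>y b - y a\<bar>" using ab(7) by (simp_all add: abs_minus_commute)
      then show ?thesis using ab by blast
    qed
  qed
  have "\<forall>\<^sub>F m in sequentially. R \<le> grid_jumps (1 / Suc i) y m v" if "t < v" for R v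
    using that
  proof (induction R arbitrary: v)
    case (Suc R)
    obtain a b where ab: "a \<in> dyadic_times" "b \<in> dyadic_times" "t < a" "a \<le> b" "b < v"
      "e \<le> \<bar>y a - y b\<bar>" using pair[OF Suc.prems] by auto
    have "\<forall>\<^sub>F m in sequentially. grid_jumps (1 / Suc i) y m a < grid_jumps (1 / Suc i) y m b"
      using ab i by (intro grid_jumps_increase) auto
    then show ?case using Suc.IH[OF ab(3)]
    proof eventually_elim
      case (elim m)
      then show ?case using grid_jumps_mono[of b v "1 / Suc i" y m] ab(5) by simp
    qed
  qed simp
  note many = this[of "t + 1"]
  obtain R where R: "\<exists>\<^sub>F m in sequentially. grid_jumps (1 / Suc i) y m (real m) \<le> R"
    using y by (auto simp: finite_oscillation_def)
  have "\<forall>\<^sub>F m in sequentially. t + 1 \<le> real m"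
    using filterlim_real_sequentially by (simp add: filterlim_at_top)
  moreover have "\<forall>\<^sub>F m in sequentially. Suc R \<le> grid_jumps (1 / Suc i) y m (t + 1)"
    by (rule many) simp
  ultimately have "\<forall>\<^sub>F m in sequentially. \<not> grid_jumps (1 / Suc i) y m (real m) \<le> R"
  proof eventually_elim
    case (elim m)
    then show ?case using grid_jumps_mono[of "t + 1" "real m" "1 / Suc i" y m] by simp
  qed
  then show False using R by (simp add: frequently_def)
qed

text \<open>
  As on the right, except that the pairs approach \<open>t\<close> from below, so the jumps are counted backwards
  from \<open>t\<close>.
\<close>

lemma finite_oscillation_left:
  assumes y: "finite_oscillation y" and e: "0 < e"
  shows "\<exists>d>0. \<forall>a\<in>dyadic_times \<inter> {t - d<..<t}. \<forall>b\<in>dyadic_times \<inter> {t - d<..<t}. \<bar>y a - y b\<bar> < e"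
proof (rule ccontr)
  assume neg: "\<not> ?thesis"
  obtain i where "inverse (real (Suc i)) < e / 2" using reals_Archimedean[of "e / 2"] e by auto
  then have i: "2 * (1 / Suc i) \<le> e" by (simp add: inverse_eq_divide)
  have pair: "\<exists>a b. a \<in> dyadic_times \<and> b \<in> dyadic_times \<and> u < a \<and> a \<le> b \<and> b < t \<and> e \<le> \<bar>y a - y b\<bar>"
    if "u < t" for u
  proof -
    obtain a b where ab: "a \<in> dyadic_times" "b \<in> dyadic_times" "u < a" "u < b" "a < t" "b < t"
      "e \<le> \<bar>y a - y b\<bar>"
      using neg \<open>u < t\<close> by (auto simp: not_less dest!: spec[of _ "t - u"])
    show ?thesis
    proof (cases "a \<le> b")
      case True
      then show ?thesis using ab by blast
    next
      case False
      then have "b \<le> a" "e \<le> \<bar>y b - y a\<bar>" using ab(7) by (simp_all add: abs_minus_commute)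
      then show ?thesis using ab by blast
    qed
  qed
  have "\<forall>\<^sub>F m in sequentially. grid_jumps (1 / Suc i) y m u + R \<le> grid_jumps (1 / Suc i) y m t"
    if "u < t" for R u
    using that
  proof (induction R arbitrary: u)
    case 0
    then show ?case by (simp add: grid_jumps_mono)
  next
    case (Suc R)
    obtain a b where ab: "a \<in> dyadic_times" "b \<in> dyadic_times" "u < a" "a \<le> b" "b < t"
      "e \<le> \<bar>y a - y b\<bar>" using pair[OF Suc.prems] by auto
    have "\<forall>\<^sub>F m in sequentially. grid_jumps (1 / Suc i) y m a < grid_jumps (1 / Suc i) y m b"
      using ab i by (intro grid_jumps_increase) auto
    then show ?case using Suc.IH[OF ab(5)]
    proof eventually_elim
      case (elim m)
      then show ?case using grid_jumps_mono[of u a "1 / Suc i" y m] ab(3) by simp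
    qed
  qed
  note many = this[of "t - 1"]
  obtain R where R: "\<exists>\<^sub>F m in sequentially. grid_jumps (1 / Suc i) y m (real m) \<le> R"
    using y by (auto simp: finite_oscillation_def)
  have "\<forall>\<^sub>F m in sequentially. t \<le> real m"
    using filterlim_real_sequentially by (simp add: filterlim_at_top)
  moreover have "\<forall>\<^sub>F m in sequentially.
      grid_jumps (1 / Suc i) y m (t - 1) + Suc R \<le> grid_jumps (1 / Suc i) y m t"
    by (rule many) simp
  ultimately have "\<forall>\<^sub>F m in sequentially. \<not> grid_jumps (1 / Suc i) y m (real m) \<le> R"
  proof eventually_elim
    case (elim m)
    then show ?case using grid_jumps_mono[of t "real m" "1 / Suc i" y m] by simp
  qed
  then show False using R by (simp add: frequently_def)
qed

definition right_limit :: "(real \<Rightarrow> real) \<Rightarrow> real \<Rightarrow> real" where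
  "right_limit y t = lim (\<lambda>n. y (dyadic_above n t))"

lemma eventually_dyadic_above_less: "t < u \<Longrightarrow> \<forall>\<^sub>F n in sequentially. dyadic_above n t < u"
  using dyadic_above_tendsto by (rule order_tendstoD)

lemma right_limit_tendsto:
  assumes y: "finite_oscillation y" and t: "0 \<le> t"
  shows "(\<lambda>n. y (dyadic_above n t)) \<longlonglongrightarrow> right_limit y t"
proof -
  have "\<exists>l. (\<lambda>n. y (dyadic_above n t)) \<longlonglongrightarrow> l"
  proof (rule real_cauchy_filter_convergent)
    fix e :: real assume "0 < e"
    then obtain d where d: "0 < d"
      "\<And>a b. a \<in> dyadic_times \<inter> {t<..<t + d} \<Longrightarrow> b \<in> dyadic_times \<inter> {t<..<t + d} \<Longrightarrow> \<bar>y a - y b\<bar> < e"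
      using finite_oscillation_right[OF y, of e t] by meson
    show "\<exists>Q. eventually Q sequentially \<and>
        (\<forall>m n. Q m \<and> Q n \<longrightarrow> \<bar>y (dyadic_above m t) - y (dyadic_above n t)\<bar> < e)"
    proof (intro exI[of _ "\<lambda>n. dyadic_above n t < t + d"] conjI allI impI)
      show "\<forall>\<^sub>F n in sequentially. dyadic_above n t < t + d"
        using d(1) by (intro eventually_dyadic_above_less) simp
      fix m n assume "dyadic_above m t < t + d \<and> dyadic_above n t < t + d"
      then show "\<bar>y (dyadic_above m t) - y (dyadic_above n t)\<bar> < e"
        using t by (intro d(2)) (auto simp: dyadic_above_dyadic dyadic_above_greater)
    qed
  qed simp
  then show ?thesis unfolding right_limit_def using convergent_LIMSEQ_iff convergent_def by blast
qed

text \<open>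
  Two right limits at points of \<open>[a, b)\<close> are limits of dyadic values inside \<open>(a, b)\<close>, which explains the
  half-open assumptions: either point may be the left end point.
\<close>

lemma right_limit_dist_le:
  assumes y: "finite_oscillation y" and st: "0 \<le> s" "0 \<le> t" "a \<le> s" "s < b" "a \<le> t" "t < b"
    and e: "\<And>p q. p \<in> dyadic_times \<inter> {a<..<b} \<Longrightarrow> q \<in> dyadic_times \<inter> {a<..<b} \<Longrightarrow> \<bar>y p - y q\<bar> < e"
  shows "\<bar>right_limit y s - right_limit y t\<bar> \<le> e"
proof (rule tendsto_upperbound)
  show "(\<lambda>n. \<bar>y (dyadic_above n s) - y (dyadic_above n t)\<bar>) \<longlonglongrightarrow> \<bar>right_limit y s - right_limit y t\<bar>"
    using y st by (intro tendsto_intros right_limit_tendsto)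
  show "\<forall>\<^sub>F n in sequentially. \<bar>y (dyadic_above n s) - y (dyadic_above n t)\<bar> \<le> e"
    using eventually_dyadic_above_less[OF st(4)] eventually_dyadic_above_less[OF st(6)]
  proof eventually_elim
    case (elim n)
    then show ?case using st
      by (intro less_imp_le e)
        (auto simp: dyadic_above_dyadic intro: le_less_trans[OF _ dyadic_above_greater])
  qed
qed simp

lemma cadlag_right_limit:
  assumes y: "finite_oscillation y"
  shows "cadlag (right_limit y)"
  unfolding cadlag_def
proof (intro conjI allI impI)
  fix t :: real assume t: "0 \<le> t"
  show "continuous (at_right t) (right_limit y)"
    unfolding continuous_within
  proof (rule tendstoI)
    fix e :: real assume e: "0 < e"
    then obtain d where d: "0 < d"
      "\<And>a b. a \<in> dyadic_times \<inter> {t<..<t + d} \<Longrightarrow> b \<in> dyadic_times \<inter> {t<..<t + d} \<Longrightarrow> \<bar>y a - y b\<bar> < e / 2"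
      using finite_oscillation_right[OF y, of "e / 2" t] by (meson half_gt_zero)
    have "\<bar>right_limit y s - right_limit y t\<bar> \<le> e / 2" if "t < s" "s < t + d" for s
      using that d t by (intro right_limit_dist_le[OF y, of _ _ t "t + d"]) auto
    then show "\<forall>\<^sub>F s in at_right t. dist (right_limit y s) (right_limit y t) < e"
      using d(1) e unfolding eventually_at_right_field
      by (intro exI[of _ "t + d"]) (force simp: dist_real_def)
  qed
next
  fix t :: real assume t: "0 < t"
  show "\<exists>l. (right_limit y \<longlongrightarrow> l) (at_left t)"
  proof (rule real_cauchy_filter_convergent)
    fix e :: real assume e: "0 < e"
    then obtain d where d: "0 < d"
      "\<And>a b. a \<in> dyadic_times \<inter> {t - d<..<t} \<Longrightarrow> b \<in> dyadic_times \<inter> {t - d<..<t} \<Longrightarrow> \<bar>y a - y b\<bar> < e / 2"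
      using finite_oscillation_left[OF y, of "e / 2" t] by (meson half_gt_zero)
    show "\<exists>Q. eventually Q (at_left t) \<and> (\<forall>r s. Q r \<and> Q s \<longrightarrow> \<bar>right_limit y r - right_limit y s\<bar> < e)"
    proof (intro exI[of _ "\<lambda>s. max 0 (t - d) < s \<and> s < t"] conjI allI impI)
      show "\<forall>\<^sub>F s in at_left t. max 0 (t - d) < s \<and> s < t"
        using t d(1) unfolding eventually_at_left_field by (intro exI[of _ "max 0 (t - d)"]) auto
      fix r s assume "(max 0 (t - d) < r \<and> r < t) \<and> (max 0 (t - d) < s \<and> s < t)"
      then have "\<bar>right_limit y r - right_limit y s\<bar> \<le> e / 2"
        using d by (intro right_limit_dist_le[OF y, of _ _ "t - d" t]) auto
      then show "\<bar>right_limit y r - right_limit y s\<bar> < e" using e by linarith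
    qed
  qed simp
qed

section \<open>Cadlag versions of bounded closed martingales\<close>

context filtered_prob_space
begin

text \<open>
  Fatou's lemma makes the lower limit of the jump counts integrable, hence almost surely finite.
\<close>

lemma martingale_finite_oscillation:
  assumes Y: "martingale P F Y" and B: "\<And>t \<omega>. 0 \<le> t \<Longrightarrow> \<bar>Y t \<omega>\<bar> \<le> B"
  shows "AE \<omega> in P. finite_oscillation (\<lambda>t. Y t \<omega>)"
  unfolding finite_oscillation_def
proof (subst AE_all_countable, rule allI)
  fix i :: nat
  define e where "e = 1 / real (Suc i)"
  define N where "N m \<omega> = grid_jumps e (\<lambda>t. Y t \<omega>) m (real m)" for m \<omega>
  have e: "0 < e" by (simp add: e_def)
  have N: "(\<lambda>\<omega>. real (N m \<omega>)) \<in> borel_measurable P" "(\<integral>\<omega>. real (N m \<omega>) \<partial>P) \<le> B\<^sup>2 / e\<^sup>2" for m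
  proof -
    have \<tau>: "mono (\<lambda>k. real k / 2 ^ m)" by (auto simp: mono_def divide_right_mono)
    note * = expected_jumps_le[OF Y B \<tau> _ e, where n = "nat \<lfloor>real m * 2 ^ m\<rfloor>"]
    show "(\<lambda>\<omega>. real (N m \<omega>)) \<in> borel_measurable P" "(\<integral>\<omega>. real (N m \<omega>) \<partial>P) \<le> B\<^sup>2 / e\<^sup>2"
      using * by (auto simp: N_def grid_jumps_def)
  qed
  have [measurable]: "(\<lambda>\<omega>. ennreal (real (N m \<omega>))) \<in> borel_measurable P" for m
    using N(1) by measurable
  have N_int: "integrable P (\<lambda>\<omega>. real (N m \<omega>))" for m
  proof (rule integrable_const_bound)
    have "real (N m \<omega>) \<le> real (nat \<lfloor>real m * 2 ^ m\<rfloor>)" for \<omega>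
      unfolding N_def grid_jumps_def of_nat_le_iff by (rule jumps_le)
    then show "AE \<omega> in P. norm (real (N m \<omega>)) \<le> real (nat \<lfloor>real m * 2 ^ m\<rfloor>)"
      by (intro AE_I2) simp
  qed (rule N(1))
  have "(\<integral>\<^sup>+\<omega>. liminf (\<lambda>m. ennreal (real (N m \<omega>))) \<partial>P) \<le> liminf (\<lambda>m. \<integral>\<^sup>+\<omega>. ennreal (real (N m \<omega>)) \<partial>P)"
    by (intro nn_integral_liminf) measurable
  also have "\<dots> \<le> liminf (\<lambda>m. ennreal (B\<^sup>2 / e\<^sup>2))"
    using N N_int by (intro Liminf_mono always_eventually allI)
      (simp add: nn_integral_eq_integral ennreal_leI)
  also have "\<dots> = ennreal (B\<^sup>2 / e\<^sup>2)" by (simp add: Liminf_const)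
  finally have "(\<integral>\<^sup>+\<omega>. liminf (\<lambda>m. ennreal (real (N m \<omega>))) \<partial>P) \<noteq> \<infinity>"
    by (auto simp: top_unique)
  then have "AE \<omega> in P. liminf (\<lambda>m. ennreal (real (N m \<omega>))) \<noteq> \<infinity>"
    by (intro nn_integral_noteq_infinite) measurable
  then show "AE \<omega> in P. \<exists>R. \<exists>\<^sub>F m in sequentially. grid_jumps (1 / Suc i) (\<lambda>t. Y t \<omega>) m (real m) \<le> R"
  proof eventually_elim
    fix \<omega> assume "liminf (\<lambda>m. ennreal (real (N m \<omega>))) \<noteq> \<infinity>"
    then obtain R where R: "liminf (\<lambda>m. ennreal (real (N m \<omega>))) \<le> of_nat R"
      using ennreal_Ex_less_of_nat[of "liminf (\<lambda>m. ennreal (real (N m \<omega>)))"]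
      by (force simp: less_top[symmetric] intro: less_imp_le)
    have "\<exists>\<^sub>F m in sequentially. N m \<omega> \<le> R"
    proof (rule ccontr)
      assume "\<not> ?thesis"
      then have "\<forall>\<^sub>F m in sequentially. Suc R \<le> N m \<omega>" by (simp add: frequently_def not_le Suc_le_eq)
      then have "\<forall>\<^sub>F m in sequentially. ennreal (real (Suc R)) \<le> ennreal (real (N m \<omega>))"
        by eventually_elim (intro ennreal_leI, simp only: of_nat_le_iff)
      then have "ennreal (real (Suc R)) \<le> liminf (\<lambda>m. ennreal (real (N m \<omega>)))"
        by (rule Liminf_bounded)
      also have "\<dots> \<le> ennreal (real R)" using R by (simp add: ennreal_of_nat_eq_real_of_nat)
      finally show False by (simp add: ennreal_le_iff)
    qed
    then show "\<exists>R. \<exists>\<^sub>F m in sequentially. grid_jumps (1 / Suc i) (\<lambda>t. Y t \<omega>) m (real m) \<le> R"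
      unfolding N_def e_def by blast
  qed
qed

lemma martingale_closedI:
  assumes X: "integrable P X" and M: "\<And>t. 0 \<le> t \<Longrightarrow> M t \<in> borel_measurable (F t)"
    and eq: "\<And>t. 0 \<le> t \<Longrightarrow> AE \<omega> in P. real_cond_exp P (F t) X \<omega> = M t \<omega>"
  shows "martingale P F M"
  unfolding martingale_def
proof (intro conjI allI impI)
  fix t :: real assume t: "0 \<le> t"
  show "M t \<in> borel_measurable (F t)" using M[OF t] .
  interpret T: finite_measure_subalgebra P "F t" using t by (rule finite_measure_subalgebra_F)
  show "integrable P (M t)"
    using T.real_cond_exp_int(1)[OF X] eq[OF t] F_measurableD[OF t M[OF t]]
    by (subst integrable_cong_AE[symmetric, of "real_cond_exp P (F t) X"]) auto
next
  fix s t :: real assume st: "0 \<le> s" "s \<le> t"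
  have t: "0 \<le> t" using st by simp
  interpret S: finite_measure_subalgebra P "F s" using st(1) by (rule finite_measure_subalgebra_F)
  have "AE \<omega> in P. real_cond_exp P (F s) (real_cond_exp P (F t) X) \<omega> = real_cond_exp P (F s) X \<omega>"
    by (rule S.real_cond_exp_nested_subalg[OF subalg_F[OF t] subalgebra_F_F[OF st] X])
  moreover have "AE \<omega> in P. real_cond_exp P (F s) (real_cond_exp P (F t) X) \<omega> = real_cond_exp P (F s) (M t) \<omega>"
    by (rule S.real_cond_exp_cong[OF eq[OF t]]) (use F_measurableD[OF t M[OF t]] F_measurableD[OF t borel_measurable_cond_exp] in auto)
  moreover note eq[OF st(1)]
  ultimately show "AE \<omega> in P. real_cond_exp P (F s) (M t) \<omega> = M s \<omega>"
    by eventually_elim simp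
qed

end

sublocale usual_filtered_prob_space \<subseteq> complete_filtered_prob_space P F
  by unfold_locales (use subalgebra_F F_mono F_complete in auto)

context usual_filtered_prob_space
begin

text \<open>
  This is where right-continuity of the filtration enters.
\<close>

lemma F_measurable_right_limit:
  fixes f :: "'a \<Rightarrow> real"
  assumes t: "0 \<le> t" and f: "\<And>s. t < s \<Longrightarrow> f \<in> borel_measurable (F s)"
  shows "f \<in> borel_measurable (F t)"
proof (rule measurableI)
  fix B :: "real set" assume B: "B \<in> sets borel"
  have sp: "space (F s) = space P" if "0 \<le> s" for s
    using subalg_F[OF that] by (auto simp: subalgebra_def)
  have "f -` B \<inter> space P \<in> sets (F s)" if "t < s" for s
    using measurable_sets[OF f[OF that] B] sp[of s] t that by simp
  then have "f -` B \<inter> space P \<in> (\<Inter>s\<in>{t<..}. sets (F s))" by blast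
  then show "f -` B \<inter> space (F t) \<in> sets (F t)" using F_right_continuous[OF t] sp[OF t] by simp
qed simp

text \<open>
  The right limits of the clipped conditional expectations along dyadic times. They are adapted to every
  later sigma-algebra, hence to \<open>F t\<close> itself, and they have the right integrals over sets in \<open>F t\<close> by
  dominated convergence.
\<close>

lemma bounded_cadlag_version:
  assumes X: "X \<in> borel_measurable P" and B: "\<And>\<omega>. 0 \<le> X \<omega>" "\<And>\<omega>. X \<omega> \<le> B"
  obtains M where "cadlag_martingale P F M" "\<And>t \<omega>. 0 \<le> t \<Longrightarrow> 0 \<le> M t \<omega> \<and> M t \<omega> \<le> B"
    "\<And>t. 0 \<le> t \<Longrightarrow> AE \<omega> in P. real_cond_exp P (F t) X \<omega> = M t \<omega>"
proof -
  have B0: "0 \<le> B" using B[of undefined] by linarith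
  have X_int: "integrable P X" using X B by (intro integrable_const_bound[of _ B]) auto
  \<comment> \<open>Clipping changes nothing almost surely and makes the bounds hold everywhere.\<close>
  define Y where "Y t \<omega> = max 0 (min B (real_cond_exp P (F t) X \<omega>))" for t \<omega>
  have Y_F: "Y t \<in> borel_measurable (F t)" for t unfolding Y_def by measurable
  have Y_bd: "0 \<le> Y t \<omega> \<and> Y t \<omega> \<le> B" for t \<omega> using B0 by (auto simp: Y_def)
  have Y_eq: "AE \<omega> in P. real_cond_exp P (F t) X \<omega> = Y t \<omega>" if t: "0 \<le> t" for t
  proof -
    interpret T: finite_measure_subalgebra P "F t" using t by (rule finite_measure_subalgebra_F)
    have "AE \<omega> in P. 0 \<le> real_cond_exp P (F t) X \<omega>"
      using B X by (intro T.real_cond_exp_pos) auto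
    moreover have "AE \<omega> in P. real_cond_exp P (F t) X \<omega> \<le> B"
      using B by (intro T.real_cond_exp_le_c X_int) auto
    ultimately show ?thesis by eventually_elim (simp add: Y_def)
  qed
  have Y_mart: "martingale P F Y" by (rule martingale_closedI[OF X_int Y_F Y_eq])
  have good: "AE \<omega> in P. finite_oscillation (\<lambda>t. Y t \<omega>)"
    by (rule martingale_finite_oscillation[OF Y_mart, of B]) (use Y_bd in auto)
  define M where
    \<comment> \<open>On the exceptional null set the value \<open>0\<close> keeps all paths cadlag and within the bounds.\<close>
    "M t \<omega> = (if finite_oscillation (\<lambda>t. Y t \<omega>) then right_limit (\<lambda>t. Y t \<omega>) t else 0)" for t \<omega>
  have M_lim: "AE \<omega> in P. (\<lambda>n. Y (dyadic_above n t) \<omega>) \<longlonglongrightarrow> M t \<omega>" if t: "0 \<le> t" for t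
    using good by eventually_elim (use right_limit_tendsto t in \<open>auto simp: M_def\<close>)
  have M_bd: "0 \<le> M t \<omega> \<and> M t \<omega> \<le> B" if t: "0 \<le> t" for t \<omega>
  proof (cases "finite_oscillation (\<lambda>t. Y t \<omega>)")
    case True
    then have lim: "(\<lambda>n. Y (dyadic_above n t) \<omega>) \<longlonglongrightarrow> M t \<omega>"
      using right_limit_tendsto[OF True t] by (simp add: M_def)
    show ?thesis
      using Y_bd by (intro conjI LIMSEQ_le_const[OF lim] LIMSEQ_le_const2[OF lim]) auto
  qed (use B0 in \<open>simp add: M_def\<close>)
  have M_F: "M t \<in> borel_measurable (F t)" if t: "0 \<le> t" for t
  proof (rule F_measurable_right_limit[OF t])
    fix s assume s: "t < s"
    obtain k where k: "\<And>n. k \<le> n \<Longrightarrow> dyadic_above n t < s"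
      using eventually_dyadic_above_less[OF s] by (auto simp: eventually_sequentially)
    have [measurable]: "Y (dyadic_above (n + k) t) \<in> borel_measurable (F s)" for n
      using k[of "n + k"] t dyadic_above_greater[of t "n + k"]
      by (intro F_measurable_mono[OF _ _ Y_F]) auto
    show "M t \<in> borel_measurable (F s)"
    proof (rule F_measurable_AE_eq)
      show "(\<lambda>\<omega>. lim (\<lambda>n. Y (dyadic_above (n + k) t) \<omega>)) \<in> borel_measurable (F s)" by measurable
      show "AE \<omega> in P. M t \<omega> = lim (\<lambda>n. Y (dyadic_above (n + k) t) \<omega>)"
        using M_lim[OF t]
      proof eventually_elim
        case (elim \<omega>)
        from LIMSEQ_ignore_initial_segment[OF this, of k] show ?case by (simp add: limI)
      qed
    qed (use s t in simp)
  qed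
  have M_meas: "M t \<in> borel_measurable P" if "0 \<le> t" for t using F_measurableD[OF that M_F[OF that]] .
  have M_eq: "AE \<omega> in P. real_cond_exp P (F t) X \<omega> = M t \<omega>" if t: "0 \<le> t" for t
  proof -
    interpret T: finite_measure_subalgebra P "F t" using t by (rule finite_measure_subalgebra_F)
    show ?thesis
    proof (rule T.real_cond_exp_charact)
      show "integrable P X" by (rule X_int)
      show "integrable P (M t)"
        using M_bd[OF t] M_meas[OF t] by (intro integrable_const_bound[of _ B]) auto
      show "M t \<in> borel_measurable (F t)" by (rule M_F[OF t])
      fix A assume A: "A \<in> sets (F t)"
      then have AP [measurable]: "A \<in> sets P" using subalg_F[OF t] by (auto simp: subalgebra_def)
      have Y_int: "(\<integral>\<omega>. indicator A \<omega> * Y (dyadic_above n t) \<omega> \<partial>P) = (\<integral>\<omega>. indicator A \<omega> * X \<omega> \<partial>P)" for n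
      proof -
        let ?u = "dyadic_above n t"
        have u: "0 \<le> ?u" "t \<le> ?u" using t dyadic_above_greater[of t n] by auto
        interpret U: finite_measure_subalgebra P "F ?u" using u(1) by (rule finite_measure_subalgebra_F)
        have "A \<in> sets (F ?u)" using A mono_F[OF t u(2)] by auto
        then have "(\<integral>\<omega>. indicator A \<omega> * X \<omega> \<partial>P) = (\<integral>\<omega>. indicator A \<omega> * real_cond_exp P (F ?u) X \<omega> \<partial>P)"
          using U.real_cond_exp_intA[OF X_int] by (simp add: set_lebesgue_integral_def)
        also have "\<dots> = (\<integral>\<omega>. indicator A \<omega> * Y ?u \<omega> \<partial>P)"
        proof (rule integral_cong_AE)
          show "AE \<omega> in P. indicator A \<omega> * real_cond_exp P (F ?u) X \<omega> = indicator A \<omega> * Y ?u \<omega>"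
            using Y_eq[OF u(1)] by eventually_elim simp
        qed (use F_measurableD[OF u(1) Y_F] F_measurableD[OF u(1) borel_measurable_cond_exp] in measurable)
        finally show ?thesis by simp
      qed
      have "(\<lambda>n. \<integral>\<omega>. indicator A \<omega> * Y (dyadic_above n t) \<omega> \<partial>P) \<longlonglongrightarrow> (\<integral>\<omega>. indicator A \<omega> * M t \<omega> \<partial>P)"
      proof (rule integral_dominated_convergence)
        show "AE \<omega> in P. (\<lambda>n. indicator A \<omega> * Y (dyadic_above n t) \<omega>) \<longlonglongrightarrow> indicator A \<omega> * M t \<omega>"
          using M_lim[OF t] by eventually_elim (intro tendsto_intros)
        show "AE \<omega> in P. norm (indicator A \<omega> * Y (dyadic_above n t) \<omega>) \<le> B" for n
          using Y_bd B0 by (auto simp: indicator_def)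
        show "(\<lambda>\<omega>. indicator A \<omega> * Y (dyadic_above n t) \<omega>) \<in> borel_measurable P" for n
          using F_measurableD[OF less_imp_le[OF le_less_trans[OF t dyadic_above_greater]] Y_F] by measurable
        show "(\<lambda>\<omega>. indicator A \<omega> * M t \<omega>) \<in> borel_measurable P"
          using M_meas[OF t] by measurable
      qed simp
      then have "(\<integral>\<omega>. indicator A \<omega> * X \<omega> \<partial>P) = (\<integral>\<omega>. indicator A \<omega> * M t \<omega> \<partial>P)"
        unfolding Y_int by (simp add: LIMSEQ_const_iff)
      then show "(\<integral>\<omega>\<in>A. X \<omega> \<partial>P) = (\<integral>\<omega>\<in>A. M t \<omega> \<partial>P)" by (simp add: set_lebesgue_integral_def)
    qed
  qed
  have "cadlag (\<lambda>t. M t \<omega>)" for \<omega>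
  proof (cases "finite_oscillation (\<lambda>t. Y t \<omega>)")
    case True
    then have "(\<lambda>t. M t \<omega>) = right_limit (\<lambda>t. Y t \<omega>)" by (auto simp: M_def)
    then show ?thesis using cadlag_right_limit[OF True] by simp
  next
    case False
    then show ?thesis by (auto simp: M_def cadlag_def)
  qed
  then have "cadlag_martingale P F M"
    using martingale_closedI[OF X_int M_F M_eq] by (simp add: cadlag_martingale_iff)
  then show thesis using M_bd M_eq by (rule that)
qed

end

section \<open>Linear combinations and dominated martingales\<close>

lemma cadlag_lincomb:
  assumes "cadlag f" "cadlag g"
  shows "cadlag (\<lambda>t. a * f t + b * g t)"
  unfolding cadlag_def
proof (intro conjI allI impI)
  fix t :: real assume "0 \<le> t"
  then show "continuous (at_right t) (\<lambda>t. a * f t + b * g t)"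
    using assms by (auto simp: cadlag_def intro!: continuous_intros)
next
  fix t :: real assume "0 < t"
  then obtain l m where "(f \<longlongrightarrow> l) (at_left t)" "(g \<longlongrightarrow> m) (at_left t)"
    using assms unfolding cadlag_def by blast
  then have "((\<lambda>t. a * f t + b * g t) \<longlongrightarrow> a * l + b * m) (at_left t)"
    by (intro tendsto_intros)
  then show "\<exists>l. ((\<lambda>t. a * f t + b * g t) \<longlongrightarrow> l) (at_left t)" by blast
qed

context filtered_prob_space
begin

lemma cadlag_martingale_lincomb:
  assumes M: "cadlag_martingale P F M" and N: "cadlag_martingale P F N"
  shows "cadlag_martingale P F (\<lambda>t \<omega>. a * M t \<omega> + b * N t \<omega>)"
  unfolding cadlag_martingale_def
proof (intro conjI allI impI ballI)
  fix \<omega> assume "\<omega> \<in> space P"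
  then show "cadlag (\<lambda>t. a * M t \<omega> + b * N t \<omega>)"
    using M N by (intro cadlag_lincomb) (auto simp: cadlag_martingale_def)
next
  fix t :: real assume t: "0 \<le> t"
  have [measurable]: "M t \<in> borel_measurable (F t)" "N t \<in> borel_measurable (F t)"
    using M N t by (simp_all add: cadlag_martingale_def)
  show "(\<lambda>\<omega>. a * M t \<omega> + b * N t \<omega>) \<in> borel_measurable (F t)" by measurable
  have "integrable P (M t)" "integrable P (N t)"
    using M N t by (simp_all add: cadlag_martingale_def)
  then show "integrable P (\<lambda>\<omega>. a * M t \<omega> + b * N t \<omega>)" by simp
next
  fix s t :: real assume st: "0 \<le> s" "s \<le> t"
  interpret S: finite_measure_subalgebra P "F s" using st(1) by (rule finite_measure_subalgebra_F)
  have "0 \<le> t" using st by simp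
  then have int: "integrable P (M t)" "integrable P (N t)"
    using M N by (simp_all add: cadlag_martingale_def)
  have eq: "AE \<omega> in P. real_cond_exp P (F s) (M t) \<omega> = M s \<omega>"
    "AE \<omega> in P. real_cond_exp P (F s) (N t) \<omega> = N s \<omega>"
    using M N st by (simp_all add: cadlag_martingale_def)
  have "AE \<omega> in P. real_cond_exp P (F s) (\<lambda>\<omega>. a * M t \<omega> + b * N t \<omega>) \<omega> =
      real_cond_exp P (F s) (\<lambda>\<omega>. a * M t \<omega>) \<omega> + real_cond_exp P (F s) (\<lambda>\<omega>. b * N t \<omega>) \<omega>"
    using int by (intro S.real_cond_exp_add) auto
  with eq S.real_cond_exp_cmult[OF int(1), of a] S.real_cond_exp_cmult[OF int(2), of b]
  show "AE \<omega> in P. real_cond_exp P (F s) (\<lambda>\<omega>. a * M t \<omega> + b * N t \<omega>) \<omega> = a * M s \<omega> + b * N s \<omega>"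
    by eventually_elim simp
qed

lemma cadlag_martingale_const: "cadlag_martingale P F (\<lambda>t \<omega>. c)"
  unfolding cadlag_martingale_def
proof (intro conjI allI impI ballI)
  fix s t :: real assume st: "0 \<le> s" "s \<le> t"
  interpret S: finite_measure_subalgebra P "F s" using st(1) by (rule finite_measure_subalgebra_F)
  show "AE \<omega> in P. real_cond_exp P (F s) (\<lambda>\<omega>. c) \<omega> = c" by (rule S.real_cond_exp_F_meas) auto
qed (auto simp: cadlag_def)

text \<open>
  For cadlag paths the supremum over dyadic times bounds all times, and unlike the supremum over all
  times it is measurable by construction.
\<close>

lemma H1_martingale_dominated:
  assumes M: "H1_martingale P F M"
  obtains S where "integrable P S" "AE \<omega> in P. \<forall>t\<ge>0. \<bar>M t \<omega>\<bar> \<le> S \<omega>"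
proof -
  have cm: "cadlag_martingale P F M" using M by (simp add: H1_martingale_def)
  have [measurable]: "M t \<in> borel_measurable P" if "0 \<le> t" for t
    using cm that by (auto simp: cadlag_martingale_def)
  define S where "S \<omega> = (SUP q\<in>dyadic_times. ennreal \<bar>M q \<omega>\<bar>)" for \<omega>
  have S_meas [measurable]: "S \<in> borel_measurable P"
    unfolding S_def by (rule borel_measurable_SUP) (auto simp: countable_dyadic_times dest: dyadic_times_nonneg)
  have "(\<integral>\<^sup>+\<omega>. S \<omega> \<partial>P) \<le> (\<integral>\<^sup>+\<omega>. (SUP t\<in>{0..}. ennreal \<bar>M t \<omega>\<bar>) \<partial>P)"
    unfolding S_def by (intro nn_integral_mono SUP_subset_mono) (auto dest: dyadic_times_nonneg)
  also have "\<dots> < \<infinity>" using M by (simp add: H1_martingale_def)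
  finally have fin: "(\<integral>\<^sup>+\<omega>. S \<omega> \<partial>P) < \<infinity>" .
  then have AE_fin: "AE \<omega> in P. S \<omega> \<noteq> \<infinity>" by (intro nn_integral_noteq_infinite) auto
  have eq: "AE \<omega> in P. ennreal (enn2real (S \<omega>)) = S \<omega>"
    using AE_fin by eventually_elim (auto simp: less_top)
  show thesis
  proof
    show "integrable P (\<lambda>\<omega>. enn2real (S \<omega>))"
    proof (rule integrableI_bounded)
      show "(\<integral>\<^sup>+\<omega>. ennreal (norm (enn2real (S \<omega>))) \<partial>P) < \<infinity>"
        using fin nn_integral_cong_AE[OF eq] by simp
    qed measurable
    show "AE \<omega> in P. \<forall>t\<ge>0. \<bar>M t \<omega>\<bar> \<le> enn2real (S \<omega>)"
      using AE_fin AE_space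
    proof eventually_elim
      fix \<omega> assume \<omega>: "S \<omega> \<noteq> \<infinity>" "\<omega> \<in> space P"
      have q: "\<bar>M q \<omega>\<bar> \<le> enn2real (S \<omega>)" if "q \<in> dyadic_times" for q
      proof -
        have "ennreal \<bar>M q \<omega>\<bar> \<le> S \<omega>" unfolding S_def using that by (rule SUP_upper)
        then have "enn2real (ennreal \<bar>M q \<omega>\<bar>) \<le> enn2real (S \<omega>)"
          using \<omega>(1) by (intro enn2real_mono) (auto simp: less_top)
        then show ?thesis by simp
      qed
      have "cadlag (\<lambda>t. M t \<omega>)" using cm \<omega>(2) by (simp add: cadlag_martingale_def)
      from cadlag_abs_le[OF this q] show "\<forall>t\<ge>0. \<bar>M t \<omega>\<bar> \<le> enn2real (S \<omega>)" by blast
    qed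
  qed
qed

lemma H1_martingaleI:
  assumes "cadlag_martingale P F M" and S: "integrable P S" and le: "AE \<omega> in P. \<forall>t\<ge>0. \<bar>M t \<omega>\<bar> \<le> S \<omega>"
  shows "H1_martingale P F M"
proof -
  have "(\<integral>\<^sup>+\<omega>. (SUP t\<in>{0..}. ennreal \<bar>M t \<omega>\<bar>) \<partial>P) \<le> (\<integral>\<^sup>+\<omega>. ennreal (norm (S \<omega>)) \<partial>P)"
  proof (rule nn_integral_mono_AE)
    show "AE \<omega> in P. (SUP t\<in>{0..}. ennreal \<bar>M t \<omega>\<bar>) \<le> ennreal (norm (S \<omega>))"
      using le by eventually_elim (auto intro!: SUP_least ennreal_leI order_trans[OF _ abs_ge_self])
  qed
  also have "\<dots> < \<infinity>" using S by (simp add: integrable_iff_bounded)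
  finally show ?thesis using assms(1) by (simp add: H1_martingale_def)
qed

lemma H1_imp_ui_martingale:
  assumes M: "H1_martingale P F M"
  shows "ui_martingale P F M"
proof -
  have cm: "cadlag_martingale P F M" using M by (simp add: H1_martingale_def)
  obtain S where S: "integrable P S" and le: "AE \<omega> in P. \<forall>t\<ge>0. \<bar>M t \<omega>\<bar> \<le> S \<omega>"
    using M by (rule H1_martingale_dominated)
  have [measurable]: "S \<in> borel_measurable P" using S by simp
  define f where "f K \<omega> = \<bar>S \<omega>\<bar> * indicator {x. K \<le> x} (S \<omega>)" for K \<omega>
  have f_meas [measurable]: "f K \<in> borel_measurable P" for K unfolding f_def indicator_def by measurable
  have f_int: "integrable P (f K)" for K
    by (rule Bochner_Integration.integrable_bound[OF S f_meas]) (auto simp: f_def indicator_def)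
  have "((\<lambda>K. \<integral>\<omega>. f K \<omega> \<partial>P) \<longlongrightarrow> (\<integral>\<omega>. 0 \<partial>P)) at_top"
  proof (rule integral_dominated_convergence_at_top)
    show "integrable P (\<lambda>\<omega>. \<bar>S \<omega>\<bar>)" using S by auto
    show "AE \<omega> in P. ((\<lambda>K. f K \<omega>) \<longlongrightarrow> 0) at_top"
    proof (rule AE_I2)
      fix \<omega>
      have "\<forall>\<^sub>F K in at_top. f K \<omega> = 0"
        using eventually_gt_at_top[of "S \<omega>"] by eventually_elim (simp add: f_def)
      then show "((\<lambda>K. f K \<omega>) \<longlongrightarrow> 0) at_top" by (rule tendsto_eventually)
    qed
  qed (auto simp: f_def indicator_def)
  then have lim: "((\<lambda>K. ennreal (\<integral>\<omega>. f K \<omega> \<partial>P)) \<longlongrightarrow> 0) at_top"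
    using tendsto_ennrealI by fastforce
  have le_f: "(SUP t\<in>{0..}. \<integral>\<^sup>+\<omega>\<in>{\<omega>. K \<le> \<bar>M t \<omega>\<bar>}. ennreal \<bar>M t \<omega>\<bar> \<partial>P) \<le> ennreal (\<integral>\<omega>. f K \<omega> \<partial>P)" for K
  proof (rule SUP_least)
    fix t :: real assume t: "t \<in> {0..}"
    have "(\<integral>\<^sup>+\<omega>\<in>{\<omega>. K \<le> \<bar>M t \<omega>\<bar>}. ennreal \<bar>M t \<omega>\<bar> \<partial>P) \<le> (\<integral>\<^sup>+\<omega>. ennreal (f K \<omega>) \<partial>P)"
    proof (rule nn_integral_mono_AE)
      show "AE \<omega> in P. ennreal \<bar>M t \<omega>\<bar> * indicator {\<omega>. K \<le> \<bar>M t \<omega>\<bar>} \<omega> \<le> ennreal (f K \<omega>)"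
        using le
      proof eventually_elim
        fix \<omega> assume "\<forall>t\<ge>0. \<bar>M t \<omega>\<bar> \<le> S \<omega>"
        then have "\<bar>M t \<omega>\<bar> \<le> S \<omega>" using t by simp
        then show "ennreal \<bar>M t \<omega>\<bar> * indicator {\<omega>. K \<le> \<bar>M t \<omega>\<bar>} \<omega> \<le> ennreal (f K \<omega>)"
          by (auto simp: f_def indicator_def intro!: ennreal_leI)
      qed
    qed
    also have "\<dots> = ennreal (\<integral>\<omega>. f K \<omega> \<partial>P)"
      by (intro nn_integral_eq_integral f_int) (simp add: f_def)
    finally show "(\<integral>\<^sup>+\<omega>\<in>{\<omega>. K \<le> \<bar>M t \<omega>\<bar>}. ennreal \<bar>M t \<omega>\<bar> \<partial>P) \<le> ennreal (\<integral>\<omega>. f K \<omega> \<partial>P)" .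
  qed
  have "((\<lambda>K. SUP t\<in>{0..}. \<integral>\<^sup>+\<omega>\<in>{\<omega>. K \<le> \<bar>M t \<omega>\<bar>}. ennreal \<bar>M t \<omega>\<bar> \<partial>P) \<longlongrightarrow> 0) at_top"
    by (rule tendsto_sandwich[OF _ _ tendsto_const lim]) (use le_f in \<open>auto intro: always_eventually\<close>)
  then show ?thesis
    using cm by (auto simp: ui_martingale_def uniformly_integrable_def cadlag_martingale_def)
qed

end

section \<open>Evaluation at a random time\<close>

context complete_filtered_prob_space
begin

text \<open>
  The random time is approximated from the right by times with countably many values. On the null
  set where the time is infinite, completeness makes the value irrelevant.
\<close>

lemma value_at_measurable:
  assumes M: "cadlag_martingale P F M" and \<rho>: "\<rho> \<in> borel_measurable P" and fin: "AE \<omega> in P. \<rho> \<omega> \<noteq> \<infinity>"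
  shows "value_at M \<rho> \<in> borel_measurable P"
proof (rule measurable_AE_eq)
  \<comment> \<open>The numerator, up to the added 1, of \<open>dyadic_above n\<close> at the random time: an integer-valued
    variable, so that the composition is measurable.\<close>
  define k where "k n \<omega> = nat \<lfloor>enn2real (\<rho> \<omega>) * 2 ^ n\<rfloor>" for n :: nat and \<omega>
  have [measurable]: "k n \<in> P \<rightarrow>\<^sub>M count_space UNIV" for n
    unfolding k_def using \<rho> by measurable
  have [measurable]: "M t \<in> borel_measurable P" if "0 \<le> t" for t
    using M that by (auto simp: cadlag_martingale_def)
  have [measurable]: "(\<lambda>\<omega>. M ((real (k n \<omega>) + 1) / 2 ^ n) \<omega>) \<in> borel_measurable P" for n
    by (rule measurable_compose_countable[where g = "k n" and f = "\<lambda>j. M ((real j + 1) / 2 ^ n)"]) simp_all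
  show "(\<lambda>\<omega>. lim (\<lambda>n. M ((real (k n \<omega>) + 1) / 2 ^ n) \<omega>)) \<in> borel_measurable P"
    by measurable
  show "AE \<omega> in P. value_at M \<rho> \<omega> = lim (\<lambda>n. M ((real (k n \<omega>) + 1) / 2 ^ n) \<omega>)"
    using fin AE_space
  proof eventually_elim
    fix \<omega> assume \<omega>: "\<rho> \<omega> \<noteq> \<infinity>" "\<omega> \<in> space P"
    have "(real (k n \<omega>) + 1) / 2 ^ n = dyadic_above n (enn2real (\<rho> \<omega>))" for n
      by (simp add: k_def dyadic_above_def)
    moreover have "(\<lambda>n. M (dyadic_above n (enn2real (\<rho> \<omega>))) \<omega>) \<longlonglongrightarrow> value_at M \<rho> \<omega>"
      using M \<omega> cadlag_dyadic_above_tendsto[of "\<lambda>t. M t \<omega>" "enn2real (\<rho> \<omega>)"]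
      by (simp add: cadlag_martingale_def value_at_def)
    ultimately show "value_at M \<rho> \<omega> = lim (\<lambda>n. M ((real (k n \<omega>) + 1) / 2 ^ n) \<omega>)"
      by (simp add: limI)
  qed
qed

lemma value_at_integrable:
  assumes M: "cadlag_martingale P F M" and \<rho>: "\<rho> \<in> borel_measurable P" and fin: "AE \<omega> in P. \<rho> \<omega> \<noteq> \<infinity>"
    and S: "integrable P S" and le: "AE \<omega> in P. \<forall>t\<ge>0. \<bar>M t \<omega>\<bar> \<le> S \<omega>"
  shows "integrable P (value_at M \<rho>)"
proof (rule Bochner_Integration.integrable_bound[OF S value_at_measurable[OF M \<rho> fin]])
  show "AE \<omega> in P. norm (value_at M \<rho> \<omega>) \<le> norm (S \<omega>)"
    using le fin by eventually_elim (auto simp: value_at_def intro: order_trans[OF _ abs_ge_self])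
qed

end

section \<open>The contraction property implies the pseudo-stopping property\<close>

text \<open>
  For \<open>n \<ge> \<bar>x\<bar>\<close> one has \<open>\<bar>n + x\<bar> - n = x\<close>, and in any case this difference is at most \<open>\<bar>x\<bar>\<close> in
  absolute value.
\<close>

lemma (in prob_space) integral_abs_shift_limit:
  assumes f: "integrable M f"
  shows "(\<lambda>n. (\<integral>\<omega>. \<bar>real n + f \<omega>\<bar> \<partial>M) - real n) \<longlonglongrightarrow> (\<integral>\<omega>. f \<omega> \<partial>M)"
proof -
  have "(\<integral>\<omega>. \<bar>real n + f \<omega>\<bar> - real n \<partial>M) = (\<integral>\<omega>. \<bar>real n + f \<omega>\<bar> \<partial>M) - real n" for n
    using f by (subst Bochner_Integration.integral_diff) (auto simp: prob_space)
  moreover have "(\<lambda>n. \<integral>\<omega>. \<bar>real n + f \<omega>\<bar> - real n \<partial>M) \<longlonglongrightarrow> (\<integral>\<omega>. f \<omega> \<partial>M)"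
  proof (rule integral_dominated_convergence)
    show "integrable M (\<lambda>\<omega>. \<bar>f \<omega>\<bar>)" using f by auto
    show "AE \<omega> in M. (\<lambda>n. \<bar>real n + f \<omega>\<bar> - real n) \<longlonglongrightarrow> f \<omega>"
    proof (rule AE_I2)
      fix \<omega>
      have "\<forall>\<^sub>F n in sequentially. \<bar>f \<omega>\<bar> \<le> real n"
        using filterlim_real_sequentially by (simp add: filterlim_at_top)
      then have "\<forall>\<^sub>F n in sequentially. \<bar>real n + f \<omega>\<bar> - real n = f \<omega>" by eventually_elim auto
      then show "(\<lambda>n. \<bar>real n + f \<omega>\<bar> - real n) \<longlonglongrightarrow> f \<omega>" by (rule tendsto_eventually)
    qed
    show "AE \<omega> in M. norm (\<bar>real n + f \<omega>\<bar> - real n) \<le> \<bar>f \<omega>\<bar>" for n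
      by (rule AE_I2) auto
  qed (use f in auto)
  ultimately show ?thesis by simp
qed

context usual_filtered_prob_space
begin

text \<open>
  The contraction property is applied to \<open>c + a M\<close> with \<open>c\<close> tending to infinity and with both signs of
  \<open>a\<close>.
\<close>

lemma contraction_imp_pseudo_stopping_time:
  assumes \<rho>: "random_time P \<rho>" and fin: "AE \<omega> in P. \<rho> \<omega> \<noteq> \<infinity>"
    and contr: "\<And>M. ui_martingale P F M \<Longrightarrow>
      (\<integral>\<^sup>+\<omega>. ennreal \<bar>value_at M \<rho> \<omega>\<bar> \<partial>P) \<le> (\<integral>\<^sup>+\<omega>. ennreal \<bar>terminal_value M \<omega>\<bar> \<partial>P)"
  shows "pseudo_stopping_time P F \<rho>"
  unfolding pseudo_stopping_time_def
proof (intro conjI allI impI \<rho>)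
  fix M assume M: "H1_martingale P F M"
  have ui: "ui_martingale P F M" by (rule H1_imp_ui_martingale[OF M])
  have cm: "cadlag_martingale P F M" using M by (simp add: H1_martingale_def)
  obtain S where S: "integrable P S" and le: "AE \<omega> in P. \<forall>t\<ge>0. \<bar>M t \<omega>\<bar> \<le> S \<omega>"
    using M by (rule H1_martingale_dominated)
  have v_int: "integrable P (value_at M \<rho>)"
    using \<rho> by (intro value_at_integrable[OF cm _ fin S le]) (simp add: random_time_def)
  have T_int: "integrable P (terminal_value M)" by (rule ui_martingale_terminal(1)[OF ui])
  have step: "(\<integral>\<omega>. \<bar>c + a * value_at M \<rho> \<omega>\<bar> \<partial>P) \<le> (\<integral>\<omega>. \<bar>c + a * terminal_value M \<omega>\<bar> \<partial>P)" for c a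
  proof -
    let ?N = "\<lambda>t \<omega>. c * 1 + a * M t \<omega>"
    have "cadlag_martingale P F ?N"
      by (rule cadlag_martingale_lincomb[OF cadlag_martingale_const cm])
    moreover have "integrable P (\<lambda>\<omega>. \<bar>c\<bar> + \<bar>a\<bar> * S \<omega>)" using S by auto
    moreover have "AE \<omega> in P. \<forall>t\<ge>0. \<bar>?N t \<omega>\<bar> \<le> \<bar>c\<bar> + \<bar>a\<bar> * S \<omega>"
      using le
    proof eventually_elim
      case (elim \<omega>)
      show ?case
      proof (intro allI impI)
        fix t :: real assume "0 \<le> t"
        then have "\<bar>a\<bar> * \<bar>M t \<omega>\<bar> \<le> \<bar>a\<bar> * S \<omega>" using elim by (intro mult_left_mono) auto
        then show "\<bar>?N t \<omega>\<bar> \<le> \<bar>c\<bar> + \<bar>a\<bar> * S \<omega>" using abs_triangle_ineq[of c "a * M t \<omega>"] by (simp add: abs_mult)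
      qed
    qed
    ultimately have "H1_martingale P F ?N" by (rule H1_martingaleI)
    then have N: "ui_martingale P F ?N" by (rule H1_imp_ui_martingale)
    have "ennreal (\<integral>\<omega>. \<bar>c + a * value_at M \<rho> \<omega>\<bar> \<partial>P) = (\<integral>\<^sup>+\<omega>. ennreal \<bar>c + a * value_at M \<rho> \<omega>\<bar> \<partial>P)"
      using v_int by (intro nn_integral_eq_integral[symmetric]) auto
    also have "\<dots> = (\<integral>\<^sup>+\<omega>. ennreal \<bar>value_at ?N \<rho> \<omega>\<bar> \<partial>P)"
      by (rule nn_integral_cong_AE) (use fin in \<open>eventually_elim, simp add: value_at_def\<close>)
    also have "\<dots> \<le> (\<integral>\<^sup>+\<omega>. ennreal \<bar>terminal_value ?N \<omega>\<bar> \<partial>P)" by (rule contr[OF N])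
    also have "\<dots> = (\<integral>\<^sup>+\<omega>. ennreal \<bar>c + a * terminal_value M \<omega>\<bar> \<partial>P)"
    proof (rule nn_integral_cong_AE)
      show "AE \<omega> in P. ennreal \<bar>terminal_value ?N \<omega>\<bar> = ennreal \<bar>c + a * terminal_value M \<omega>\<bar>"
        using ui_martingale_terminal_limit[OF ui]
      proof eventually_elim
        case (elim \<omega>)
        then have "((\<lambda>t. ?N t \<omega>) \<longlongrightarrow> c * 1 + a * terminal_value M \<omega>) at_top"
          by (intro tendsto_intros)
        then have "terminal_value ?N \<omega> = c * 1 + a * terminal_value M \<omega>"
          unfolding terminal_value_def[of ?N] by (intro tendsto_Lim) auto
        then show ?case by simp
      qed
    qed
    also have "\<dots> = ennreal (\<integral>\<omega>. \<bar>c + a * terminal_value M \<omega>\<bar> \<partial>P)"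
      using T_int by (intro nn_integral_eq_integral) auto
    finally show ?thesis by (simp add: ennreal_le_iff)
  qed
  have signed: "(\<integral>\<omega>. a * value_at M \<rho> \<omega> \<partial>P) \<le> (\<integral>\<omega>. a * terminal_value M \<omega> \<partial>P)" for a
  proof (rule LIMSEQ_le)
    show "(\<lambda>n. (\<integral>\<omega>. \<bar>real n + a * value_at M \<rho> \<omega>\<bar> \<partial>P) - real n) \<longlonglongrightarrow> (\<integral>\<omega>. a * value_at M \<rho> \<omega> \<partial>P)"
      using v_int by (intro integral_abs_shift_limit) simp
    show "(\<lambda>n. (\<integral>\<omega>. \<bar>real n + a * terminal_value M \<omega>\<bar> \<partial>P) - real n) \<longlonglongrightarrow> (\<integral>\<omega>. a * terminal_value M \<omega> \<partial>P)"
      using T_int by (intro integral_abs_shift_limit) simp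
  qed (use step in auto)
  have "(\<integral>\<omega>. value_at M \<rho> \<omega> \<partial>P) = (\<integral>\<omega>. terminal_value M \<omega> \<partial>P)"
    using signed[of 1] signed[of "-1"] by simp
  also have "\<dots> = (\<integral>\<omega>. M 0 \<omega> \<partial>P)"
    using ui_martingale_closed[OF ui order_refl, of "\<lambda>_. 1" 1] by simp
  finally show "(\<integral>\<omega>. value_at M \<rho> \<omega> \<partial>P) = (\<integral>\<omega>. M 0 \<omega> \<partial>P)" .
qed

end

section \<open>The pseudo-stopping property implies the contraction property\<close>

lemma integral_truncation_error_tendsto:
  assumes f: "integrable P f"
  shows "(\<lambda>k::nat. \<integral>\<omega>. max 0 (\<bar>f \<omega>\<bar> - real k) \<partial>P) \<longlonglongrightarrow> 0"
proof -
  have [measurable]: "f \<in> borel_measurable P" using f by simp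
  have "(\<lambda>k::nat. \<integral>\<omega>. max 0 (\<bar>f \<omega>\<bar> - real k) \<partial>P) \<longlonglongrightarrow> (\<integral>\<omega>. 0 \<partial>P)"
  proof (rule integral_dominated_convergence)
    show "integrable P (\<lambda>\<omega>. \<bar>f \<omega>\<bar>)" using f by auto
    show "AE \<omega> in P. (\<lambda>k. max 0 (\<bar>f \<omega>\<bar> - real k)) \<longlonglongrightarrow> 0"
    proof (rule AE_I2)
      fix \<omega>
      have "\<forall>\<^sub>F k in sequentially. \<bar>f \<omega>\<bar> \<le> real k"
        using filterlim_real_sequentially by (simp add: filterlim_at_top)
      then have "\<forall>\<^sub>F k in sequentially. max 0 (\<bar>f \<omega>\<bar> - real k) = 0" by eventually_elim auto
      then show "(\<lambda>k. max 0 (\<bar>f \<omega>\<bar> - real k)) \<longlonglongrightarrow> 0" by (rule tendsto_eventually)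
    qed
  qed auto
  then show ?thesis by simp
qed

context usual_filtered_prob_space
begin

lemma pseudo_stopping_time_bounded_version:
  assumes \<rho>: "pseudo_stopping_time P F \<rho>" and fin: "AE \<omega> in P. \<rho> \<omega> \<noteq> \<infinity>"
    and X: "X \<in> borel_measurable P" "\<And>\<omega>. 0 \<le> X \<omega>" "\<And>\<omega>. X \<omega> \<le> B"
  obtains N where "cadlag_martingale P F N" "\<And>t. 0 \<le> t \<Longrightarrow> AE \<omega> in P. real_cond_exp P (F t) X \<omega> = N t \<omega>"
    "AE \<omega> in P. 0 \<le> value_at N \<rho> \<omega>" "integrable P (value_at N \<rho>)"
    "(\<integral>\<omega>. value_at N \<rho> \<omega> \<partial>P) = (\<integral>\<omega>. X \<omega> \<partial>P)"
proof -
  obtain N where N: "cadlag_martingale P F N" "\<And>t \<omega>. 0 \<le> t \<Longrightarrow> 0 \<le> N t \<omega> \<and> N t \<omega> \<le> B"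
    "\<And>t. 0 \<le> t \<Longrightarrow> AE \<omega> in P. real_cond_exp P (F t) X \<omega> = N t \<omega>"
    using bounded_cadlag_version[OF X] by blast
  have B: "integrable P (\<lambda>_. B)" "AE \<omega> in P. \<forall>t\<ge>0. \<bar>N t \<omega>\<bar> \<le> B" using N(2) by auto
  interpret T: finite_measure_subalgebra P "F 0" by (rule finite_measure_subalgebra_F) simp
  have X_int: "integrable P X" using X by (intro integrable_const_bound[of _ B]) auto
  have \<rho>m: "\<rho> \<in> borel_measurable P" using \<rho> by (simp add: pseudo_stopping_time_def random_time_def)
  show thesis
  proof (rule that[OF N(1) N(3)])
    show "AE \<omega> in P. 0 \<le> value_at N \<rho> \<omega>"
      using fin by eventually_elim (simp add: value_at_def N(2))
    show "integrable P (value_at N \<rho>)"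
      by (rule value_at_integrable[OF N(1) \<rho>m fin B])
    have "(\<integral>\<omega>. value_at N \<rho> \<omega> \<partial>P) = (\<integral>\<omega>. N 0 \<omega> \<partial>P)"
      using \<rho> H1_martingaleI[OF N(1) B] by (simp add: pseudo_stopping_time_def)
    also have "\<dots> = (\<integral>\<omega>. real_cond_exp P (F 0) X \<omega> \<partial>P)"
      using N(1) N(3)[of 0] F_measurableD[OF order_refl borel_measurable_cond_exp]
      by (intro integral_cong_AE) (auto simp: cadlag_martingale_def elim: eventually_mono)
    also have "\<dots> = (\<integral>\<omega>. X \<omega> \<partial>P)" by (rule T.real_cond_exp_int(2)[OF X_int])
    finally show "(\<integral>\<omega>. value_at N \<rho> \<omega> \<partial>P) = (\<integral>\<omega>. X \<omega> \<partial>P)" .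
  qed
qed

text \<open>
  Here \<open>A\<close> and \<open>D\<close> are the martingales closed by the positive and negative parts of \<open>T\<close>, cut off at \<open>k\<close>.
  Outside the exceptional event \<open>E\<close> of the maximal inequality, \<open>M\<close> is within \<open>l\<close> of \<open>A - D\<close> at all times,
  in particular at \<open>\<rho>\<close>. On \<open>E\<close> the truncation at \<open>L\<close> is what bounds the integrand.
\<close>

lemma pseudo_stopping_time_truncated_estimate:
  fixes k :: nat
  assumes \<rho>: "pseudo_stopping_time P F \<rho>" and fin: "AE \<omega> in P. \<rho> \<omega> \<noteq> \<infinity>"
    and M: "ui_martingale P F M" and l: "0 < l" and L: "0 \<le> L"
  defines "T \<equiv> terminal_value M"
  shows "(\<integral>\<omega>. min \<bar>value_at M \<rho> \<omega>\<bar> L \<partial>P) \<le>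
    (\<integral>\<omega>. \<bar>T \<omega>\<bar> \<partial>P) + l + L * ((\<integral>\<omega>. max 0 (\<bar>T \<omega>\<bar> - real k) \<partial>P) / l)"
proof -
  have cm: "cadlag_martingale P F M" using M by (simp add: ui_martingale_def)
  have T_int: "integrable P T" unfolding T_def by (rule ui_martingale_terminal(1)[OF M])
  have [measurable]: "T \<in> borel_measurable P" using T_int by simp
  define U where "U \<omega> = min (real k) (max 0 (T \<omega>))" for \<omega>
  define V where "V \<omega> = min (real k) (max 0 (- T \<omega>))" for \<omega>
  have UV_meas [measurable]: "U \<in> borel_measurable P" "V \<in> borel_measurable P"
    unfolding U_def V_def by measurable
  have UV_bd: "0 \<le> U \<omega>" "U \<omega> \<le> real k" "0 \<le> V \<omega>" "V \<omega> \<le> real k" for \<omega>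
    by (auto simp: U_def V_def)
  have UV_int: "integrable P U" "integrable P V"
    using UV_bd by (auto intro!: integrable_const_bound[of _ "real k"])
  obtain A where A: "cadlag_martingale P F A" "\<And>t. 0 \<le> t \<Longrightarrow> AE \<omega> in P. real_cond_exp P (F t) U \<omega> = A t \<omega>"
    "AE \<omega> in P. 0 \<le> value_at A \<rho> \<omega>" "integrable P (value_at A \<rho>)"
    "(\<integral>\<omega>. value_at A \<rho> \<omega> \<partial>P) = (\<integral>\<omega>. U \<omega> \<partial>P)"
    using pseudo_stopping_time_bounded_version[OF \<rho> fin UV_meas(1) UV_bd(1,2)] by blast
  obtain D where D: "cadlag_martingale P F D" "\<And>t. 0 \<le> t \<Longrightarrow> AE \<omega> in P. real_cond_exp P (F t) V \<omega> = D t \<omega>"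
    "AE \<omega> in P. 0 \<le> value_at D \<rho> \<omega>" "integrable P (value_at D \<rho>)"
    "(\<integral>\<omega>. value_at D \<rho> \<omega> \<partial>P) = (\<integral>\<omega>. V \<omega> \<partial>P)"
    using pseudo_stopping_time_bounded_version[OF \<rho> fin UV_meas(2) UV_bd(3,4)] by blast
  define Z where "Z t \<omega> = M t \<omega> - (A t \<omega> - D t \<omega>)" for t \<omega>
  have "cadlag_martingale P F (\<lambda>t \<omega>. 1 * M t \<omega> + - 1 * (1 * A t \<omega> + - 1 * D t \<omega>))"
    by (intro cadlag_martingale_lincomb cm A D)
  then have Z: "cadlag_martingale P F Z" by (simp add: Z_def[abs_def] algebra_simps)
  define c where "c = (\<integral>\<omega>. max 0 (\<bar>T \<omega>\<bar> - real k) \<partial>P)"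
  \<comment> \<open>The sign of \<open>Z t\<close> is a test function known at time \<open>t\<close>, so each martingale may be replaced by the
    variable that closes it.\<close>
  have Z_L1: "(\<integral>\<omega>. \<bar>Z t \<omega>\<bar> \<partial>P) \<le> c" if t: "0 \<le> t" for t
  proof -
    define h where "h \<omega> = sgn (Z t \<omega>)" for \<omega>
    have [measurable]: "Z t \<in> borel_measurable (F t)" using Z t by (simp add: cadlag_martingale_def)
    have h: "h \<in> borel_measurable (F t)" unfolding h_def by measurable
    have h1: "\<bar>h \<omega>\<bar> \<le> 1" for \<omega> by (simp add: h_def sgn_if)
    have hP [measurable]: "h \<in> borel_measurable P" by (rule F_measurableD[OF t h])
    have h_int: "integrable P (\<lambda>\<omega>. h \<omega> * f \<omega>)" if "integrable P f" for f
    proof (rule Bochner_Integration.integrable_bound[OF that])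
      show "AE \<omega> in P. norm (h \<omega> * f \<omega>) \<le> norm (f \<omega>)"
        using mult_right_mono[OF h1] by (auto simp: abs_mult)
      show "(\<lambda>\<omega>. h \<omega> * f \<omega>) \<in> borel_measurable P" using that by measurable
    qed
    have ints: "integrable P (M t)" "integrable P (A t)" "integrable P (D t)"
      using cm A(1) D(1) t by (auto simp: cadlag_martingale_def)
    have "(\<integral>\<omega>. \<bar>Z t \<omega>\<bar> \<partial>P) = (\<integral>\<omega>. h \<omega> * M t \<omega> - (h \<omega> * A t \<omega> - h \<omega> * D t \<omega>) \<partial>P)"
    proof (rule Bochner_Integration.integral_cong[OF refl])
      fix \<omega>
      have "\<bar>Z t \<omega>\<bar> = h \<omega> * Z t \<omega>" by (simp add: h_def sgn_if)
      then show "\<bar>Z t \<omega>\<bar> = h \<omega> * M t \<omega> - (h \<omega> * A t \<omega> - h \<omega> * D t \<omega>)"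
        by (simp add: Z_def algebra_simps)
    qed
    also have "\<dots> = (\<integral>\<omega>. h \<omega> * M t \<omega> \<partial>P) - ((\<integral>\<omega>. h \<omega> * A t \<omega> \<partial>P) - (\<integral>\<omega>. h \<omega> * D t \<omega> \<partial>P))"
      using ints h_int by simp
    also have "\<dots> = (\<integral>\<omega>. h \<omega> * T \<omega> \<partial>P) - ((\<integral>\<omega>. h \<omega> * U \<omega> \<partial>P) - (\<integral>\<omega>. h \<omega> * V \<omega> \<partial>P))"
      using cond_exp_integral_mult[OF t UV_int(1) _ A(2)[OF t] h h1]
        cond_exp_integral_mult[OF t UV_int(2) _ D(2)[OF t] h h1] ints
        ui_martingale_closed[OF M t h h1] by (simp add: T_def)
    also have "\<dots> = (\<integral>\<omega>. h \<omega> * T \<omega> - (h \<omega> * U \<omega> - h \<omega> * V \<omega>) \<partial>P)"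
      using T_int UV_int h_int by simp
    also have "\<dots> \<le> c" unfolding c_def
    proof (rule integral_mono)
      show "integrable P (\<lambda>\<omega>. h \<omega> * T \<omega> - (h \<omega> * U \<omega> - h \<omega> * V \<omega>))"
        using T_int UV_int h_int by auto
      show "integrable P (\<lambda>\<omega>. max 0 (\<bar>T \<omega>\<bar> - real k))" using T_int by auto
      fix \<omega>
      have "h \<omega> * T \<omega> - (h \<omega> * U \<omega> - h \<omega> * V \<omega>) = h \<omega> * (T \<omega> - U \<omega> + V \<omega>)"
        by (simp add: algebra_simps)
      also have "\<dots> \<le> \<bar>h \<omega>\<bar> * \<bar>T \<omega> - U \<omega> + V \<omega>\<bar>" by (simp add: abs_mult[symmetric])
      also have "\<dots> \<le> \<bar>T \<omega> - U \<omega> + V \<omega>\<bar>" using mult_right_mono[OF h1] by fastforce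
      also have "\<dots> = max 0 (\<bar>T \<omega>\<bar> - real k)" by (auto simp: U_def V_def min_def max_def)
      finally show "h \<omega> * T \<omega> - (h \<omega> * U \<omega> - h \<omega> * V \<omega>) \<le> max 0 (\<bar>T \<omega>\<bar> - real k)" .
    qed
    finally show ?thesis .
  qed
  define E where "E = {\<omega> \<in> space P. \<exists>q\<in>dyadic_times. l < \<bar>Z q \<omega>\<bar>}"
  have Z_mart: "martingale P F Z" using Z by (simp add: cadlag_martingale_iff)
  have E [measurable]: "E \<in> sets P" and E_le: "measure P E \<le> c / l"
    unfolding E_def using maximal_inequality[OF Z_mart l Z_L1] by auto
  have \<rho>m: "\<rho> \<in> borel_measurable P" using \<rho> by (simp add: pseudo_stopping_time_def random_time_def)
  have [measurable]: "value_at M \<rho> \<in> borel_measurable P" by (rule value_at_measurable[OF cm \<rho>m fin])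
  have ind_int: "integrable P (indicator E :: 'a \<Rightarrow> real)"
    by (intro integrable_real_indicator) (auto simp: less_top[symmetric])
  have "(\<integral>\<omega>. min \<bar>value_at M \<rho> \<omega>\<bar> L \<partial>P) \<le>
      (\<integral>\<omega>. value_at A \<rho> \<omega> + value_at D \<rho> \<omega> + l + L * indicator E \<omega> \<partial>P)"
  proof (rule integral_mono_AE)
    show "integrable P (\<lambda>\<omega>. min \<bar>value_at M \<rho> \<omega>\<bar> L)"
      using L by (intro integrable_const_bound[of _ L]) auto
    show "integrable P (\<lambda>\<omega>. value_at A \<rho> \<omega> + value_at D \<rho> \<omega> + l + L * indicator E \<omega>)"
      using A(4) D(4) ind_int by auto
    show "AE \<omega> in P. min \<bar>value_at M \<rho> \<omega>\<bar> L \<le> value_at A \<rho> \<omega> + value_at D \<rho> \<omega> + l + L * indicator E \<omega>"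
      using A(3) D(3) fin AE_space
    proof eventually_elim
      case (elim \<omega>)
      show ?case
      proof (cases "\<omega> \<in> E")
        case True
        then show ?thesis using elim l by simp
      next
        case False
        have "\<bar>Z t \<omega>\<bar> \<le> l" if "0 \<le> t" for t
        proof (rule cadlag_abs_le[OF _ _ that])
          show "cadlag (\<lambda>t. Z t \<omega>)" using Z elim(4) by (simp add: cadlag_martingale_def)
          show "\<bar>Z q \<omega>\<bar> \<le> l" if "q \<in> dyadic_times" for q
            using False elim(4) that by (force simp: E_def)
        qed
        then have "\<bar>Z (enn2real (\<rho> \<omega>)) \<omega>\<bar> \<le> l" by simp
        then show ?thesis using False elim by (simp add: value_at_def Z_def)
      qed
    qed
  qed
  also have "\<dots> = (\<integral>\<omega>. U \<omega> \<partial>P) + (\<integral>\<omega>. V \<omega> \<partial>P) + l + L * measure P E"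
    using A(4,5) D(4,5) ind_int by (simp add: prob_space)
  also have "\<dots> = (\<integral>\<omega>. U \<omega> + V \<omega> \<partial>P) + l + L * measure P E" using UV_int by simp
  also have "\<dots> \<le> (\<integral>\<omega>. \<bar>T \<omega>\<bar> \<partial>P) + l + L * (c / l)"
  proof (intro add_mono order_refl mult_left_mono E_le L)
    show "(\<integral>\<omega>. U \<omega> + V \<omega> \<partial>P) \<le> (\<integral>\<omega>. \<bar>T \<omega>\<bar> \<partial>P)"
      using UV_int T_int by (intro integral_mono) (auto simp: U_def V_def)
  qed
  finally show ?thesis by (simp add: c_def)
qed

text \<open>
  In the truncated estimate the limits are taken in the order \<open>k\<close> to infinity, \<open>l\<close> to zero, \<open>L\<close> to
  infinity.
\<close>

lemma pseudo_stopping_time_imp_contraction: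
  assumes \<rho>: "pseudo_stopping_time P F \<rho>" and fin: "AE \<omega> in P. \<rho> \<omega> \<noteq> \<infinity>"
    and M: "ui_martingale P F M"
  shows "(\<integral>\<^sup>+\<omega>. ennreal \<bar>value_at M \<rho> \<omega>\<bar> \<partial>P) \<le> (\<integral>\<^sup>+\<omega>. ennreal \<bar>terminal_value M \<omega>\<bar> \<partial>P)"
proof -
  let ?T = "terminal_value M" and ?v = "value_at M \<rho>"
  have T_int: "integrable P ?T" by (rule ui_martingale_terminal(1)[OF M])
  have \<rho>m: "\<rho> \<in> borel_measurable P" using \<rho> by (simp add: pseudo_stopping_time_def random_time_def)
  have [measurable]: "?v \<in> borel_measurable P"
    using M by (intro value_at_measurable[OF _ \<rho>m fin]) (simp add: ui_martingale_def)
  have bound: "(\<integral>\<omega>. min \<bar>?v \<omega>\<bar> L \<partial>P) \<le> (\<integral>\<omega>. \<bar>?T \<omega>\<bar> \<partial>P)" if L: "0 \<le> L" for L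
  proof (rule field_le_epsilon)
    fix l :: real assume l: "0 < l"
    show "(\<integral>\<omega>. min \<bar>?v \<omega>\<bar> L \<partial>P) \<le> (\<integral>\<omega>. \<bar>?T \<omega>\<bar> \<partial>P) + l"
    proof (rule LIMSEQ_le_const)
      have "(\<lambda>k. (\<integral>\<omega>. \<bar>?T \<omega>\<bar> \<partial>P) + l + L * ((\<integral>\<omega>. max 0 (\<bar>?T \<omega>\<bar> - real k) \<partial>P) / l))
          \<longlonglongrightarrow> (\<integral>\<omega>. \<bar>?T \<omega>\<bar> \<partial>P) + l + L * (0 / l)"
        using l by (intro tendsto_intros integral_truncation_error_tendsto T_int) simp
      then show "(\<lambda>k. (\<integral>\<omega>. \<bar>?T \<omega>\<bar> \<partial>P) + l + L * ((\<integral>\<omega>. max 0 (\<bar>?T \<omega>\<bar> - real k) \<partial>P) / l))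
          \<longlonglongrightarrow> (\<integral>\<omega>. \<bar>?T \<omega>\<bar> \<partial>P) + l" by simp
    qed (use pseudo_stopping_time_truncated_estimate[OF \<rho> fin M l L] in blast)
  qed
  have "(\<integral>\<^sup>+\<omega>. ennreal \<bar>?v \<omega>\<bar> \<partial>P) = (\<integral>\<^sup>+\<omega>. liminf (\<lambda>L. ennreal (min \<bar>?v \<omega>\<bar> (real L))) \<partial>P)"
  proof (rule nn_integral_cong)
    fix \<omega>
    have "\<forall>\<^sub>F L in sequentially. \<bar>?v \<omega>\<bar> \<le> real L"
      using filterlim_real_sequentially by (simp add: filterlim_at_top)
    then have "\<forall>\<^sub>F L in sequentially. ennreal (min \<bar>?v \<omega>\<bar> (real L)) = ennreal \<bar>?v \<omega>\<bar>"
      by eventually_elim simp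
    then have "(\<lambda>L. ennreal (min \<bar>?v \<omega>\<bar> (real L))) \<longlonglongrightarrow> ennreal \<bar>?v \<omega>\<bar>"
      by (rule tendsto_eventually)
    then show "ennreal \<bar>?v \<omega>\<bar> = liminf (\<lambda>L. ennreal (min \<bar>?v \<omega>\<bar> (real L)))"
      by (intro lim_imp_Liminf[symmetric]) auto
  qed
  also have "\<dots> \<le> liminf (\<lambda>L. \<integral>\<^sup>+\<omega>. ennreal (min \<bar>?v \<omega>\<bar> (real L)) \<partial>P)"
    by (intro nn_integral_liminf) measurable
  also have "\<dots> \<le> liminf (\<lambda>L::nat. ennreal (\<integral>\<omega>. \<bar>?T \<omega>\<bar> \<partial>P))"
  proof (intro Liminf_mono always_eventually allI)
    fix L :: nat
    have "(\<integral>\<^sup>+\<omega>. ennreal (min \<bar>?v \<omega>\<bar> (real L)) \<partial>P) = ennreal (\<integral>\<omega>. min \<bar>?v \<omega>\<bar> (real L) \<partial>P)"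
      by (intro nn_integral_eq_integral integrable_const_bound[of _ "real L"]) auto
    then show "(\<integral>\<^sup>+\<omega>. ennreal (min \<bar>?v \<omega>\<bar> (real L)) \<partial>P) \<le> ennreal (\<integral>\<omega>. \<bar>?T \<omega>\<bar> \<partial>P)"
      using bound[of "real L"] by (simp add: ennreal_leI)
  qed
  also have "\<dots> = (\<integral>\<^sup>+\<omega>. ennreal \<bar>?T \<omega>\<bar> \<partial>P)"
    using T_int by (simp add: Liminf_const nn_integral_eq_integral)
  finally show ?thesis .
qed

end

section \<open>The equivalence\<close>

theorem proposition1:
  fixes P :: "'a measure" and F :: "real \<Rightarrow> 'a measure" and \<rho> :: "'a \<Rightarrow> ennreal"
  assumes "usual_filtered_prob_space P F"
    and "random_time P \<rho>"
    and "measure P {\<omega> \<in> space P. \<rho> \<omega> = \<infinity>} = 0"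
  shows "pseudo_stopping_time P F \<rho> \<longleftrightarrow>
    (\<forall>M. ui_martingale P F M \<longrightarrow>
      (\<integral>\<^sup>+\<omega>. ennreal \<bar>value_at M \<rho> \<omega>\<bar> \<partial>P) \<le> (\<integral>\<^sup>+\<omega>. ennreal \<bar>terminal_value M \<omega>\<bar> \<partial>P))"
proof -
  interpret usual_filtered_prob_space P F by fact
  have [measurable]: "\<rho> \<in> borel_measurable P" using assms(2) by (simp add: random_time_def)
  have "AE \<omega> in P. \<omega> \<notin> {\<omega> \<in> space P. \<rho> \<omega> = \<infinity>}"
    using assms(3) by (intro AE_not_in null_setsI) (simp_all add: emeasure_eq_measure)
  then have fin: "AE \<omega> in P. \<rho> \<omega> \<noteq> \<infinity>" using AE_space by eventually_elim simp
  show ?thesis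
    using pseudo_stopping_time_imp_contraction[OF _ fin]
      contraction_imp_pseudo_stopping_time[OF assms(2) fin] by blast
qed

end
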